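(* Every divisor of positive degree on a tropical curve $\Gamma$ is ample.
   Context: A tropical curve $\Gamma$ is a compact connected metric graph whose leaf edges may have infinite length (with a point at infinity added). Divisors are finite formal $\mathbb Z$-combinations of points of $\Gamma$; the degree is the sum of coefficients. A rational function is a continuous function on $\Gamma$, piecewise linear with finitely many pieces and integer slopes (real-valued, except possibly $\pm\infty$ at points at infinity); $(f)=\sum_x\mathrm{ord}_x(f)\cdot x$ where $\mathrm{ord}_x(f)$ is the sum of outgoing slopes at $x$. $R(D)=\{f:D+(f)\ge0\}$. A divisor $D$ is very ample if $R(D)$ separates points: for every $x\ne x'$ in $\Gamma$ there are $f,f'\in R(D)$ with $f(x)-f(x')\ne f'(x)-f'(x')$ (equivalently, the rational function $f-f'$ takes different values at $x$ and $x'$; this is how the condition is read when $x$ or $x'$ is a point at infinity). $D$ is ample if some positive multiple $kD$ is very ample. *)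

theory Defs
  imports "HOL-Analysis.Analysis" "Graph_Theory.Digraph"
begin

text \<open>
  A metric graph is presented by a finite multigraph (loops and parallel edges allowed) and a
  length in \<open>(0, \<infinity>]\<close> for every edge. The orientation of an edge \<open>e\<close> only serves to fix a
  parametrisation of \<open>e\<close> by the interval \<open>[0, len e]\<close> of extended reals, from tail to head. An edge
  of infinite length is oriented towards its infinite end, which has to be a vertex of valence 1
  (a loop counts twice for the valence); that vertex is the point at infinity. An infinite edge thus
  has exactly one end at infinity: the curve \<open>[-\<infinity>, \<infinity>]\<close> is presented by two edges.
\<close>

datatype ('v, 'e) point = Vertex 'v | Inner 'e real

locale metric_graph = fin_digraph G for G :: "('v, 'e) pre_digraph" (structure) +
  fixes len :: "'e \<Rightarrow> ereal"
  assumes len_pos: "e \<in> arcs G \<Longrightarrow> 0 < len e"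
    and infinite_leaf:
      "e \<in> arcs G \<Longrightarrow> len e = \<infinity> \<Longrightarrow> in_degree G (head G e) + out_degree G (head G e) = 1"
begin

definition points :: "('v, 'e) point set" where
  "points = Vertex ` verts G \<union> {Inner e t | e t. e \<in> arcs G \<and> 0 < t \<and> ereal t < len e}"

definition points_at_infinity :: "('v, 'e) point set" where
  "points_at_infinity = {Vertex (head G e) | e. e \<in> arcs G \<and> len e = \<infinity>}"

definition on_edge :: "'e \<Rightarrow> ereal \<Rightarrow> ('v, 'e) point" where
  "on_edge e t = (if t = 0 then Vertex (tail G e)
                  else if t = len e then Vertex (head G e)
                  else Inner e (real_of_ereal t))"

text \<open>The quotient topology of the disjoint union of the vertices and the closed edges.\<close>

definition curve_open :: "('v, 'e) point set \<Rightarrow> bool" where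
  "curve_open U \<longleftrightarrow> U \<subseteq> points \<and>
     (\<forall>e \<in> arcs G. openin (top_of_set {0..len e}) {t \<in> {0..len e}. on_edge e t \<in> U})"

definition curve_topology :: "('v, 'e) point topology" where
  "curve_topology = topology curve_open"

lemma on_edge_in_points:
  assumes "e \<in> arcs G" "t \<in> {0..len e}"
  shows "on_edge e t \<in> points"
proof (cases "t = 0 \<or> t = len e")
  case True
  then show ?thesis using assms by (auto simp: on_edge_def points_def)
next
  case False
  with assms have "0 < t" "t < len e" by auto
  then obtain r where "t = ereal r" by (cases t) auto
  with False \<open>0 < t\<close> \<open>t < len e\<close> assms show ?thesis by (auto simp: on_edge_def points_def)
qed

lemma istopology_curve_open: "istopology curve_open"
  unfolding istopology_def
proof (intro conjI allI impI)
  fix S T assume S: "curve_open S" and T: "curve_open T"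
  show "curve_open (S \<inter> T)"
    unfolding curve_open_def
  proof (intro conjI ballI)
    show "S \<inter> T \<subseteq> points" using S by (auto simp: curve_open_def)
    fix e assume "e \<in> arcs G"
    then have "openin (top_of_set {0..len e})
        ({t \<in> {0..len e}. on_edge e t \<in> S} \<inter> {t \<in> {0..len e}. on_edge e t \<in> T})"
      using S T by (intro openin_Int) (simp_all add: curve_open_def)
    also have "{t \<in> {0..len e}. on_edge e t \<in> S} \<inter> {t \<in> {0..len e}. on_edge e t \<in> T} =
        {t \<in> {0..len e}. on_edge e t \<in> S \<inter> T}" by blast
    finally show "openin (top_of_set {0..len e}) {t \<in> {0..len e}. on_edge e t \<in> S \<inter> T}" .
  qed
next
  fix K assume K: "\<forall>U\<in>K. curve_open U"
  show "curve_open (\<Union>K)"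
    unfolding curve_open_def
  proof (intro conjI ballI)
    show "\<Union>K \<subseteq> points" using K by (auto simp: curve_open_def)
    fix e assume "e \<in> arcs G"
    then have "openin (top_of_set {0..len e}) (\<Union>U\<in>K. {t \<in> {0..len e}. on_edge e t \<in> U})"
      using K by (intro openin_Union ballI) (force simp: curve_open_def)
    also have "(\<Union>U\<in>K. {t \<in> {0..len e}. on_edge e t \<in> U}) =
        {t \<in> {0..len e}. on_edge e t \<in> \<Union>K}" by blast
    finally show "openin (top_of_set {0..len e}) {t \<in> {0..len e}. on_edge e t \<in> \<Union>K}" .
  qed
qed

lemma openin_curve_topology: "openin curve_topology = curve_open"
  unfolding curve_topology_def by (rule topology_inverse'[OF istopology_curve_open])

lemma topspace_curve_topology: "topspace curve_topology = points"
proof -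
  have "{t \<in> {0..len e}. on_edge e t \<in> points} = {0..len e}" if "e \<in> arcs G" for e
    using on_edge_in_points[OF that] by auto
  then have "curve_open points" by (simp add: curve_open_def)
  then show ?thesis
    unfolding topspace_def openin_curve_topology by (auto simp: curve_open_def)
qed

definition pl_on_edge :: "(('v, 'e) point \<Rightarrow> ereal) \<Rightarrow> 'e \<Rightarrow> bool" where
  "pl_on_edge f e \<longleftrightarrow>
     (\<exists>(n::nat) (b :: nat \<Rightarrow> ereal). b 0 = 0 \<and> b n = len e \<and>
        (\<forall>i<n. b i < b (Suc i) \<and>
           (\<exists>(m::int) (c::real). \<forall>s::real. b i \<le> ereal s \<and> ereal s \<le> b (Suc i) \<longrightarrow>
              f (on_edge e (ereal s)) = ereal (of_int m * s + c))))"

definition rational_function :: "(('v, 'e) point \<Rightarrow> ereal) \<Rightarrow> bool" where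
  "rational_function f \<longleftrightarrow>
     continuous_map curve_topology euclidean f \<and>
     (\<forall>x \<in> points - points_at_infinity. \<bar>f x\<bar> \<noteq> \<infinity>) \<and>
     (\<forall>e \<in> arcs G. pl_on_edge f e)"

text \<open>
  Slopes are taken in the direction of the parametrisation. As the affine pieces are compared on a
  punctured one-sided neighbourhood only, the left slope also makes sense at the parameter \<open>\<infinity>\<close>,
  where it is the slope of \<open>f\<close> on the unbounded piece of the edge.
\<close>

definition right_slope :: "(('v, 'e) point \<Rightarrow> ereal) \<Rightarrow> 'e \<Rightarrow> ereal \<Rightarrow> int" where
  "right_slope f e t = (THE m. \<exists>c::real.
     \<forall>\<^sub>F s in at_right t. f (on_edge e s) = ereal (of_int m * real_of_ereal s + c))"

definition left_slope :: "(('v, 'e) point \<Rightarrow> ereal) \<Rightarrow> 'e \<Rightarrow> ereal \<Rightarrow> int" where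
  "left_slope f e t = (THE m. \<exists>c::real.
     \<forall>\<^sub>F s in at_left t. f (on_edge e s) = ereal (of_int m * real_of_ereal s + c))"

text \<open>
  The sum of the outgoing slopes: the direction against the parametrisation contributes the
  negative of the left slope. A loop at \<open>v\<close> contributes two directions.
\<close>

fun ord_at :: "(('v, 'e) point \<Rightarrow> ereal) \<Rightarrow> ('v, 'e) point \<Rightarrow> int" where
  "ord_at f (Vertex v) =
     (\<Sum>e \<in> out_arcs G v. right_slope f e 0) + (\<Sum>e \<in> in_arcs G v. - left_slope f e (len e))"
| "ord_at f (Inner e t) = right_slope f e (ereal t) + (- left_slope f e (ereal t))"

definition divisor :: "(('v, 'e) point \<Rightarrow> int) \<Rightarrow> bool" where
  "divisor D \<longleftrightarrow> finite {x. D x \<noteq> 0} \<and> {x. D x \<noteq> 0} \<subseteq> points"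

definition degree :: "(('v, 'e) point \<Rightarrow> int) \<Rightarrow> int" where
  "degree D = (\<Sum>x | D x \<noteq> 0. D x)"

definition R :: "(('v, 'e) point \<Rightarrow> int) \<Rightarrow> (('v, 'e) point \<Rightarrow> ereal) set" where
  "R D = {f. rational_function f \<and> (\<forall>x \<in> points. 0 \<le> D x + ord_at f x)}"

text \<open>
  The difference of two rational functions as a rational function. It is prescribed at the points
  that are not at infinity, which are dense; its values at infinity, where \<open>f x - g x\<close> may be of the
  form \<open>\<infinity> - \<infinity>\<close>, are determined by continuity.
\<close>

definition is_difference ::
    "(('v, 'e) point \<Rightarrow> ereal) \<Rightarrow> (('v, 'e) point \<Rightarrow> ereal) \<Rightarrow> (('v, 'e) point \<Rightarrow> ereal) \<Rightarrow> bool" where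
  "is_difference h f g \<longleftrightarrow>
     rational_function h \<and> (\<forall>x \<in> points - points_at_infinity. h x = f x - g x)"

definition very_ample :: "(('v, 'e) point \<Rightarrow> int) \<Rightarrow> bool" where
  "very_ample D \<longleftrightarrow>
     (\<forall>x \<in> points. \<forall>x' \<in> points. x \<noteq> x' \<longrightarrow>
        (\<exists>f \<in> R D. \<exists>f' \<in> R D. \<exists>h. is_difference h f f' \<and> h x \<noteq> h x'))"

definition ample :: "(('v, 'e) point \<Rightarrow> int) \<Rightarrow> bool" where
  "ample D \<longleftrightarrow> (\<exists>k::nat. 0 < k \<and> very_ample (\<lambda>x. int k * D x))"

end

locale tropical_curve = metric_graph +
  assumes nonempty: "verts G \<noteq> {}"
    and connected: "connected_space curve_topology"

end

theory Submission
  imports Defs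
begin

text \<open>
  The heart of the matter is that a divisor \<open>D\<close> of degree at least \<open>2 |E|\<close> is equivalent to an
  effective one. Over the reals this is the solvability of a graph Laplace equation: there is a
  potential on the vertices whose extension to the edges, with a kink cancelling \<open>D\<close> at every
  interior point of its support, leaves each end of each edge a reserve of one unit of slope.
  Rounding the initial slope of an edge down to an integer, and raising it by one at the right
  interior point to reach the prescribed value at the head, costs less than one unit at either end
  and only adds a zero in the interior.

  A point \<open>x\<close> is separated from all others by a tent function with small support around \<open>x\<close> whose
  poles are bounded by \<open>N x\<close>, where \<open>N = 2 |E| + 2\<close>. If \<open>k D - N x\<close> is equivalent to an effective
  divisor via \<open>f\<close>, then \<open>f\<close> and its sum with the tent both lie in \<open>R (k D)\<close>.
\<close>

section \<open>The Laplace equation on a finite weighted graph\<close>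

text \<open>A resistor network with conductances \<open>w\<close> and injected currents
  \<open>c\<close>. The cut condition is connectedness, in a form that passes to the network left
  after the removal of a vertex; \<open>sum c V = 0\<close> is the compatibility condition of the
  equation.\<close>

lemma weighted_laplacian_solution:
  fixes w :: "'a \<Rightarrow> 'a \<Rightarrow> real" and c :: "'a \<Rightarrow> real"
  assumes "finite V" "V \<noteq> {}"
    and "\<And>u v. w u v = w v u" "\<And>u v. 0 \<le> w u v"
    and "\<And>A. A \<subseteq> V \<Longrightarrow> A \<noteq> {} \<Longrightarrow> A \<noteq> V \<Longrightarrow> \<exists>u\<in>A. \<exists>v\<in>V - A. 0 < w u v"
    and "sum c V = 0"
  shows "\<exists>\<phi>. \<forall>v\<in>V. c v + (\<Sum>u\<in>V. w v u * (\<phi> u - \<phi> v)) = 0"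
  using assms
proof (induction V arbitrary: w c rule: finite_ne_induct)
  case (singleton x)
  then show ?case by simp
next
  case (insert z V)
  \<comment> \<open>Gaussian elimination of the unknown at \<open>z\<close>: the Schur complement is again a Laplacian.\<close>
  define d where "d = (\<Sum>u\<in>V. w z u)"
  \<comment> \<open>The cut around \<open>z\<close> alone provides a neighbour, so the pivot
    \<open>d\<close> of the elimination is positive.\<close>
  have "\<exists>u\<in>{z}. \<exists>v\<in>insert z V - {z}. 0 < w u v"
    using insert.hyps by (intro insert.prems(3)) auto
  then obtain v where v: "v \<in> V" "0 < w z v" by auto
  then have d: "0 < d"
    unfolding d_def using insert.prems(2) insert.hyps(1) by (intro sum_pos2[of V v]) auto
  \<comment> \<open>The star at \<open>z\<close> becomes a mesh of conductances between its
    neighbours, and the current injected at \<open>z\<close> is shared among them in proportion to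
    \<open>w v z\<close>. Diagonal weights created here are harmless, being multiplied by
    \<open>\<phi> v - \<phi> v\<close>.\<close>
  define w' where "w' u v = w u v + w u z * w z v / d" for u v
  define c' where "c' v = c v + c z * w v z / d" for v
  have dsum: "(\<Sum>v\<in>V. w v z) = d" unfolding d_def using insert.prems(1) by (metis (mono_tags))
  have "sum c' V = sum c V + c z * (\<Sum>v\<in>V. w v z) / d"
    unfolding c'_def by (simp add: sum.distrib sum_distrib_left sum_divide_distrib)
  also have "\<dots> = sum c V + c z" using d dsum by simp
  also have "\<dots> = 0" using insert.prems(4) insert.hyps by simp
  finally have c'0: "sum c' V = 0" .
  have "\<exists>\<phi>. \<forall>v\<in>V. c' v + (\<Sum>u\<in>V. w' v u * (\<phi> u - \<phi> v)) = 0"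
  proof (rule insert.IH)
    show "w' u v = w' v u" for u v
      unfolding w'_def using insert.prems(1)[of u v] insert.prems(1)[of u z] insert.prems(1)[of v z]
      by simp
    show "0 \<le> w' u v" for u v
      unfolding w'_def using insert.prems(2) d by simp
    show "sum c' V = 0" by (rule c'0)
    fix A assume A: "A \<subseteq> V" "A \<noteq> {}" "A \<noteq> V"
    have mono: "0 < w' u v" if "0 < w u v" for u v
      unfolding w'_def using that insert.prems(2) d by (simp add: add_pos_nonneg)
    \<comment> \<open>Two cuts of the larger network are used, with \<open>z\<close> outside and
      inside of \<open>A\<close>. If both edges found end at \<open>z\<close>, the path through
      \<open>z\<close> creates a positive new weight; otherwise one of them already joins
      \<open>A\<close> to \<open>V - A\<close>.\<close>
    have "\<exists>u\<in>A. \<exists>v\<in>insert z V - A. 0 < w u v"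
      using A insert.hyps by (intro insert.prems(3)) auto
    then obtain u v where uv: "u \<in> A" "v \<in> insert z V - A" "0 < w u v" by blast
    have "\<exists>u\<in>insert z A. \<exists>v\<in>insert z V - insert z A. 0 < w u v"
      using A insert.hyps by (intro insert.prems(3)) auto
    then obtain u' v' where uv': "u' \<in> insert z A" "v' \<in> V - A" "v' \<noteq> z" "0 < w u' v'" by blast
    show "\<exists>u\<in>A. \<exists>v\<in>V - A. 0 < w' u v"
    proof (cases "v = z \<and> u' = z")
      case True
      then have "0 < w' u v'"
        unfolding w'_def using uv uv' d insert.prems(2) by (simp add: add_nonneg_pos)
      then show ?thesis using uv uv' by blast
    next
      case False
      then show ?thesis using uv uv' mono by blast
    qed
  qed
  then obtain \<phi> where \<phi>: "\<And>v. v \<in> V \<Longrightarrow> c' v + (\<Sum>u\<in>V. w' v u * (\<phi> u - \<phi> v)) = 0" by blast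
  \<comment> \<open>\<open>p\<close> solves the equation at \<open>z\<close> for the eliminated
    unknown. Inserting it turns the equations for \<open>w'\<close> and \<open>c'\<close> back into
    those for \<open>w\<close> and \<open>c\<close>.\<close>
  define p where "p = ((\<Sum>u\<in>V. w z u * \<phi> u) + c z) / d"
  define \<psi> where "\<psi> = \<phi>(z := p)"
  have zV: "z \<notin> V" by fact
  have \<psi>V: "(\<Sum>u\<in>V. w v u * (\<psi> u - q)) = (\<Sum>u\<in>V. w v u * (\<phi> u - q))" for v q
    unfolding \<psi>_def using zV by (intro sum.cong) auto
  have pd: "p * d = (\<Sum>u\<in>V. w z u * \<phi> u) + c z" unfolding p_def using d by simp
  have "c v + (\<Sum>u\<in>insert z V. w v u * (\<psi> u - \<psi> v)) = 0" if "v \<in> insert z V" for v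
  proof (cases "v = z")
    case True
    have "(\<Sum>u\<in>insert z V. w z u * (\<psi> u - \<psi> z)) = (\<Sum>u\<in>V. w z u * (\<phi> u - p))"
      using insert.hyps \<psi>V[of z p] by (simp add: \<psi>_def)
    also have "\<dots> = (\<Sum>u\<in>V. w z u * \<phi> u) - p * d"
      by (simp add: d_def algebra_simps sum_subtractf sum_distrib_left)
    finally show ?thesis using pd True by simp
  next
    case False
    then have v: "v \<in> V" using that by simp
    have "(\<Sum>u\<in>V. w' v u * (\<phi> u - \<phi> v)) =
        (\<Sum>u\<in>V. w v u * (\<phi> u - \<phi> v)) + w v z / d * (\<Sum>u\<in>V. w z u * (\<phi> u - \<phi> v))"
      unfolding sum_distrib_left sum.distrib[symmetric] w'_def
      by (intro sum.cong) (auto simp: distrib_right)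
    also have "(\<Sum>u\<in>V. w z u * (\<phi> u - \<phi> v)) = (\<Sum>u\<in>V. w z u * \<phi> u) - \<phi> v * d"
      by (simp add: d_def algebra_simps sum_subtractf sum_distrib_left)
    also have "w v z / d * \<dots> = w v z * (p - \<phi> v) - c z * w v z / d"
    proof -
      have "(\<Sum>u\<in>V. w z u * \<phi> u) = p * d - c z" using pd by simp
      then show ?thesis using d by (simp only:) (simp add: field_simps)
    qed
    finally have "c v + w v z * (p - \<phi> v) + (\<Sum>u\<in>V. w v u * (\<phi> u - \<phi> v)) = 0"
      using \<phi>[OF v] by (simp add: c'_def)
    then show ?thesis using insert.hyps \<psi>V[of v "\<phi> v"] False by (simp add: \<psi>_def)
  qed
  then show ?case by blast
qed

section \<open>Sums of hinge functions\<close>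

text \<open>For \<open>w\<close> of finite support, the piecewise linear function that vanishes to
  the left of all kinks and whose slope jumps by \<open>w t\<close> at \<open>t\<close>: the second
  primitive of the measure with masses \<open>w t\<close>.\<close>

definition hinges :: "(real \<Rightarrow> int) \<Rightarrow> real \<Rightarrow> real" where
  "hinges w s = (\<Sum>t | w t \<noteq> 0. of_int (w t) * max 0 (s - t))"

lemma hinges_superset:
  assumes "finite T" "{t. w t \<noteq> 0} \<subseteq> T"
  shows "hinges w s = (\<Sum>t\<in>T. of_int (w t) * max 0 (s - t))"
  unfolding hinges_def using assms by (intro sum.mono_neutral_left) auto

lemma hinges_add:
  assumes "finite {t. w t \<noteq> 0}" "finite {t. w' t \<noteq> 0}"
  shows "hinges (\<lambda>t. w t + w' t) s = hinges w s + hinges w' s"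
proof -
  \<comment> \<open>Masses may cancel in the sum and shrink its support, so all three sums are taken
    over one common set.\<close>
  let ?T = "{t. w t \<noteq> 0} \<union> {t. w' t \<noteq> 0}"
  have "finite ?T" using assms by simp
  then show ?thesis
    by (subst (1 2 3) hinges_superset[of ?T]) (auto simp: sum.distrib algebra_simps)
qed

text \<open>\<open>P\<close> selects the hinges that are switched on at \<open>s\<close>. As a hinge
  vanishes at its own kink, the choice is free for \<open>t = s\<close>, and one statement serves
  closed pieces, one-sided germs and whole edges.\<close>

lemma hinges_affine:
  assumes "finite {t. w t \<noteq> 0}"
    and "\<And>t. w t \<noteq> 0 \<Longrightarrow> P t \<Longrightarrow> t \<le> s" "\<And>t. w t \<noteq> 0 \<Longrightarrow> \<not> P t \<Longrightarrow> s \<le> t"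
  shows "hinges w s = of_int (\<Sum>t | w t \<noteq> 0 \<and> P t. w t) * s - (\<Sum>t | w t \<noteq> 0 \<and> P t. of_int (w t) * t)"
proof -
  have "hinges w s = (\<Sum>t | w t \<noteq> 0. if P t then of_int (w t) * (s - t) else 0)"
    unfolding hinges_def by (intro sum.cong) (auto simp: max_def dest: assms(2,3))
  also have "\<dots> = (\<Sum>t | w t \<noteq> 0 \<and> P t. of_int (w t) * (s - t))"
    using assms(1) by (subst sum.inter_filter[symmetric]) auto
  finally show ?thesis
    by (simp add: right_diff_distrib sum_subtractf sum_distrib_right)
qed

lemma continuous_on_hinges: "continuous_on A (hinges w)"
  unfolding hinges_def [abs_def] by (intro continuous_intros)

text \<open>Yields the breakpoints that \<open>pl_on_edge\<close> asks for, by enumerating the kinks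
  and the two ends of an edge in increasing order.\<close>

lemma strict_partition_containing:
  fixes S :: "'a::linorder set"
  assumes "finite S" "lo \<in> S" "hi \<in> S" "\<forall>x\<in>S. lo \<le> x \<and> x \<le> hi"
  shows "\<exists>(n::nat) b. b 0 = lo \<and> b n = hi \<and> (\<forall>i\<le>n. b i \<in> S) \<and>
    (\<forall>i<n. b i < b (Suc i) \<and> (\<forall>x\<in>S. x \<le> b i \<or> b (Suc i) \<le> x))"
proof -
  let ?xs = "sorted_list_of_set S"
  let ?b = "\<lambda>i. ?xs ! i" and ?n = "card S - 1"
  have len: "length ?xs = card S" and set: "set ?xs = S" using assms(1) by auto
  have sorted: "sorted_wrt (<) ?xs" by simp
  have pos: "0 < card S" using assms(1,2) card_gt_0_iff by blast
  have idx: "\<exists>j<card S. x = ?b j" if "x \<in> S" for x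
    using that len set by (metis in_set_conv_nth)
  have mono: "?b i \<le> ?b j" if "i \<le> j" "j < card S" for i j
    using that len by (simp add: sorted_nth_mono)
  have mem: "?b i \<in> S" if "i < card S" for i using that len set nth_mem by metis
  have "?b 0 = lo" using idx[OF assms(2)] mono[of 0] mem[OF pos] assms(4) pos
    by (metis antisym le0)
  moreover have "?b ?n = hi"
  proof (rule antisym)
    show "?b ?n \<le> hi" using mem[of ?n] pos assms(4) by simp
    obtain j where "j < card S" "hi = ?b j" using idx[OF assms(3)] by blast
    then show "hi \<le> ?b ?n" using mono[of j ?n] by simp
  qed
  moreover have "?b i \<in> S" if "i \<le> ?n" for i using mem that pos by simp
  moreover have "?b i < ?b (Suc i)" if "i < ?n" for i
    using sorted_wrt_nth_less[OF sorted, of i "Suc i"] that len by simp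
  moreover have "x \<le> ?b i \<or> ?b (Suc i) \<le> x" if "i < ?n" "x \<in> S" for i x
  proof -
    obtain j where "j < card S" "x = ?b j" using idx[OF \<open>x \<in> S\<close>] by blast
    then show ?thesis using mono[of j i] mono[of "Suc i" j] that(1) by (cases "j \<le> i") auto
  qed
  ultimately show ?thesis by (intro exI[of _ ?n] exI[of _ ?b]) blast
qed

lemma hinges_single:
  "hinges (\<lambda>t. if b \<and> t = u then 1 else 0) s = (if b then max 0 (s - u) else 0)"
  by (subst hinges_superset[of "{u}"]) auto

section \<open>One-sided germs and slopes\<close>

lemma eventually_at_right_Ioo:
  "t < x \<Longrightarrow> \<forall>\<^sub>F s in at_right t. t < s \<and> s < (x::ereal)"
  by (subst eventually_at_right[of t x]) auto

lemma eventually_at_left_Ioo: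
  "x < t \<Longrightarrow> \<forall>\<^sub>F s in at_left t. x < s \<and> s < (t::ereal)"
  by (subst eventually_at_left[of x t]) auto

text \<open>Affine functions of different slopes agree at one real parameter at most, and the filter
  avoids each real parameter. An abstract filter covers both sides, including the left
  neighbourhoods of \<infinity>; this makes the descriptions in \<open>right_slope\<close> and
  \<open>left_slope\<close> definite.\<close>

lemma affine_slope_unique:
  fixes F :: "ereal filter" and m m' :: int
  assumes "F \<noteq> bot" "\<And>r. \<forall>\<^sub>F s in F. s \<noteq> ereal r" "\<forall>\<^sub>F s in F. \<bar>s\<bar> \<noteq> \<infinity>"
    and "\<forall>\<^sub>F s in F. f s = ereal (of_int m * real_of_ereal s + c)"
    and "\<forall>\<^sub>F s in F. f s = ereal (of_int m' * real_of_ereal s + c')"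
  shows "m = m'"
proof (rule ccontr)
  assume "m \<noteq> m'"
  then have ne: "of_int m - of_int m' \<noteq> (0::real)" by simp
  have "\<forall>\<^sub>F s in F. False"
    using assms(2)[of "(c' - c) / (of_int m - of_int m')"] assms(3,4,5)
  proof eventually_elim
    case (elim s)
    then have "of_int m * real_of_ereal s + c = of_int m' * real_of_ereal s + c'" by simp
    then have "real_of_ereal s = (c' - c) / (of_int m - of_int m')"
      using ne by (simp add: field_simps)
    then show False using elim by (metis ereal_real')
  qed
  then show False using assms(1) by (simp add: eventually_False)
qed

context metric_graph
begin

lemma right_slope_eqI:
  assumes "t < \<infinity>" "0 \<le> t"
    and "\<forall>\<^sub>F s in at_right t. f (on_edge e s) = ereal (of_int m * real_of_ereal s + c)"
  shows "right_slope f e t = m"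
proof -
  have fin: "\<forall>\<^sub>F s in at_right t. \<bar>s\<bar> \<noteq> \<infinity>"
    using eventually_at_right_Ioo[OF assms(1)] by eventually_elim (use assms(2) in auto)
  have nb: "at_right t \<noteq> bot"
  proof
    assume "at_right t = bot"
    then have "\<forall>\<^sub>F s in at_right t. False" by simp
    then obtain b where "b > t" "\<And>s. t < s \<Longrightarrow> s < b \<Longrightarrow> False"
      unfolding eventually_at_right[OF assms(1)] by blast
    then show False using dense[of t b] by blast
  qed
  show ?thesis
    unfolding right_slope_def
  proof (rule the_equality)
    fix m' assume "\<exists>c'::real. \<forall>\<^sub>F s in at_right t. f (on_edge e s) = ereal (of_int m' * real_of_ereal s + c')"
    then show "m' = m"
      using affine_slope_unique[OF nb eventually_neq_at_within fin _ assms(3)] by blast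
  qed (use assms(3) in blast)
qed

lemma left_slope_eqI:
  assumes "0 < t"
    and "\<forall>\<^sub>F s in at_left t. f (on_edge e s) = ereal (of_int m * real_of_ereal s + c)"
  shows "left_slope f e t = m"
proof -
  have fin: "\<forall>\<^sub>F s in at_left t. \<bar>s\<bar> \<noteq> \<infinity>"
    using eventually_at_left_Ioo[OF assms(1)] by eventually_elim auto
  have nb: "at_left t \<noteq> bot"
  proof
    assume "at_left t = bot"
    then have "\<forall>\<^sub>F s in at_left t. False" by simp
    then obtain b where "b < t" "\<And>s. b < s \<Longrightarrow> s < t \<Longrightarrow> False"
      unfolding eventually_at_left[OF assms(1)] by blast
    then show False using dense[of b t] by blast
  qed
  show ?thesis
    unfolding left_slope_def
  proof (rule the_equality)
    fix m' assume "\<exists>c'::real. \<forall>\<^sub>F s in at_left t. f (on_edge e s) = ereal (of_int m' * real_of_ereal s + c')"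
    then show "m' = m"
      using affine_slope_unique[OF nb eventually_neq_at_within fin _ assms(2)] by blast
  qed (use assms(2) in blast)
qed

section \<open>Ends at infinity\<close>

lemma finite_in_out_arcs [simp]: "finite (in_arcs G v)" "finite (out_arcs G v)"
  by (auto intro: finite_subset[OF _ finite_arcs] simp: in_arcs_def out_arcs_def)

definition at_infinity :: "'v \<Rightarrow> bool" where
  "at_infinity v \<longleftrightarrow> (\<exists>e\<in>arcs G. len e = \<infinity> \<and> head G e = v)"

text \<open>The arc \<open>e\<close> uses up the valence 1 imposed by \<open>infinite_leaf\<close>,
  which leaves room neither for another arc nor for a loop.\<close>

lemma arcs_at_infinite_head:
  assumes "e \<in> arcs G" "len e = \<infinity>"
  shows "in_arcs G (head G e) = {e}" "out_arcs G (head G e) = {}"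
proof -
  have e: "e \<in> in_arcs G (head G e)" using assms by simp
  then have "card (in_arcs G (head G e)) > 0" using finite_in_out_arcs card_gt_0_iff by blast
  then have c: "card (in_arcs G (head G e)) = 1" "card (out_arcs G (head G e)) = 0"
    using infinite_leaf[OF assms] unfolding in_degree_def out_degree_def by linarith+
  show "in_arcs G (head G e) = {e}" using c(1) e by (metis card_1_singletonE singletonD)
  show "out_arcs G (head G e) = {}" using c(2) by simp
qed

lemma tail_not_at_infinity: "e \<in> arcs G \<Longrightarrow> \<not> at_infinity (tail G e)"
  unfolding at_infinity_def using arcs_at_infinite_head(2) by fastforce

lemma head_not_at_infinity: "e \<in> arcs G \<Longrightarrow> len e \<noteq> \<infinity> \<Longrightarrow> \<not> at_infinity (head G e)"
  unfolding at_infinity_def using arcs_at_infinite_head(1) by (metis in_in_arcs_conv singletonD)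

lemma points_at_infinity_iff [simp]:
  "Vertex v \<in> points_at_infinity \<longleftrightarrow> at_infinity v" "Inner e t \<notin> points_at_infinity"
  unfolding points_at_infinity_def at_infinity_def by auto

section \<open>Piecewise linear functions given by slopes and kinks\<close>

definition final_slope :: "('e \<Rightarrow> int) \<Rightarrow> ('e \<Rightarrow> real \<Rightarrow> int) \<Rightarrow> 'e \<Rightarrow> int" where
  "final_slope m W e = m e + (\<Sum>t | W e t \<noteq> 0. W e t)"

definition edge_value ::
    "('v \<Rightarrow> real) \<Rightarrow> ('e \<Rightarrow> int) \<Rightarrow> ('e \<Rightarrow> real \<Rightarrow> int) \<Rightarrow> 'e \<Rightarrow> real \<Rightarrow> real" where
  "edge_value \<phi> m W e s = \<phi> (tail G e) + of_int (m e) * s + hinges (W e) s"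

text \<open>
  A piecewise linear function is given by its values \<open>\<phi>\<close> at the finite vertices, its initial slopes
  \<open>m\<close> along the edges, and the changes of slope \<open>W e t\<close> at interior points. The value of \<open>\<phi>\<close> at a
  vertex at infinity is irrelevant; the function takes there the limit along the infinite edge,
  computed with \<open>0 * \<infinity> = 0\<close>.
\<close>

definition pl_data :: "('v \<Rightarrow> real) \<Rightarrow> ('e \<Rightarrow> int) \<Rightarrow> ('e \<Rightarrow> real \<Rightarrow> int) \<Rightarrow> bool" where
  "pl_data \<phi> m W \<longleftrightarrow>
     (\<forall>e\<in>arcs G. finite {t. W e t \<noteq> 0} \<and> (\<forall>t. W e t \<noteq> 0 \<longrightarrow> 0 < t \<and> ereal t < len e) \<and>
        (\<forall>l. len e = ereal l \<longrightarrow> edge_value \<phi> m W e l = \<phi> (head G e)))"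

definition pl_function ::
    "('v \<Rightarrow> real) \<Rightarrow> ('e \<Rightarrow> int) \<Rightarrow> ('e \<Rightarrow> real \<Rightarrow> int) \<Rightarrow> ('v, 'e) point \<Rightarrow> ereal" where
  "pl_function \<phi> m W x = (case x of
      Inner e t \<Rightarrow> ereal (edge_value \<phi> m W e t)
    | Vertex v \<Rightarrow>
        if at_infinity v then
          (let e = THE e. e \<in> arcs G \<and> head G e = v in
            ereal (of_int (final_slope m W e)) * \<infinity> +
            ereal (\<phi> (tail G e) - (\<Sum>t | W e t \<noteq> 0. of_int (W e t) * t)))
        else ereal (\<phi> v))"

definition vertex_ord :: "('e \<Rightarrow> int) \<Rightarrow> ('e \<Rightarrow> real \<Rightarrow> int) \<Rightarrow> 'v \<Rightarrow> int" where
  "vertex_ord m W v = (\<Sum>e\<in>out_arcs G v. m e) - (\<Sum>e\<in>in_arcs G v. final_slope m W e)"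

lemma pl_dataD:
  assumes "pl_data \<phi> m W" "e \<in> arcs G"
  shows "finite {t. W e t \<noteq> 0}" "W e t \<noteq> 0 \<Longrightarrow> 0 < t" "W e t \<noteq> 0 \<Longrightarrow> ereal t < len e"
    "len e = ereal l \<Longrightarrow> edge_value \<phi> m W e l = \<phi> (head G e)"
  using assms unfolding pl_data_def by auto

lemma edge_value_affine:
  assumes "pl_data \<phi> m W" "e \<in> arcs G"
    and "\<And>t. W e t \<noteq> 0 \<Longrightarrow> P t \<Longrightarrow> t \<le> s" "\<And>t. W e t \<noteq> 0 \<Longrightarrow> \<not> P t \<Longrightarrow> s \<le> t"
  shows "edge_value \<phi> m W e s = of_int (m e + (\<Sum>t | W e t \<noteq> 0 \<and> P t. W e t)) * s +
    (\<phi> (tail G e) - (\<Sum>t | W e t \<noteq> 0 \<and> P t. of_int (W e t) * t))"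
  unfolding edge_value_def
  using hinges_affine[of "W e" P s, OF pl_dataD(1)[OF assms(1,2)] assms(3,4)]
  by (simp add: algebra_simps)

text \<open>The closing condition in \<open>pl_data\<close> makes the edge formula agree with the
  vertex value at a finite head, so one formula holds at all real parameters of the closed
  edge.\<close>

lemma pl_function_on_edge:
  assumes "pl_data \<phi> m W" "e \<in> arcs G" "0 \<le> s" "ereal s \<le> len e"
  shows "pl_function \<phi> m W (on_edge e (ereal s)) = ereal (edge_value \<phi> m W e s)"
proof -
  consider "s = 0" | "0 < s" "ereal s = len e" | "0 < s" "ereal s \<noteq> len e"
    using assms(3) by force
  then show ?thesis
  proof cases
    case 1
    have "edge_value \<phi> m W e 0 = \<phi> (tail G e)"
      using edge_value_affine[OF assms(1,2), of "\<lambda>_. False" 0] pl_dataD(2)[OF assms(1,2)]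
      by (simp add: less_imp_le)
    then show ?thesis
      using 1 tail_not_at_infinity[OF assms(2)]
      by (simp add: on_edge_def pl_function_def flip: zero_ereal_def)
  next
    case 2
    note l = 2(2)[symmetric]
    then show ?thesis
      using 2(1) head_not_at_infinity[OF assms(2)] pl_dataD(4)[OF assms(1,2) l]
      by (simp add: on_edge_def pl_function_def)
  next
    case 3
    then show ?thesis by (simp add: on_edge_def pl_function_def flip: zero_ereal_def)
  qed
qed

lemma pl_function_on_edge_infinity:
  assumes "e \<in> arcs G" "len e = \<infinity>"
  shows "pl_function \<phi> m W (on_edge e \<infinity>) = ereal (of_int (final_slope m W e)) * \<infinity> +
            ereal (\<phi> (tail G e) - (\<Sum>t | W e t \<noteq> 0. of_int (W e t) * t))"
proof -
  have "(THE e'. e' \<in> arcs G \<and> head G e' = head G e) = e"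
  proof (rule the_equality)
    fix e' assume "e' \<in> arcs G \<and> head G e' = head G e"
    then have "e' \<in> in_arcs G (head G e)" by simp
    then show "e' = e" using arcs_at_infinite_head(1)[OF assms] by simp
  qed (use assms in simp)
  moreover have "at_infinity (head G e)" using assms by (auto simp: at_infinity_def)
  ultimately show ?thesis using assms(2) by (simp add: on_edge_def pl_function_def)
qed

lemma pl_on_edge_pl_function:
  assumes "pl_data \<phi> m W" "e \<in> arcs G"
  shows "pl_on_edge (pl_function \<phi> m W) e"
proof -
  let ?T = "{t. W e t \<noteq> 0}" and ?f = "pl_function \<phi> m W"
  let ?S = "{0, len e} \<union> ereal ` ?T"
  note D = pl_dataD[OF assms]
  have fin: "finite ?S" using D(1) by simp
  have S: "\<forall>x\<in>?S. 0 \<le> x \<and> x \<le> len e"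
    using D(2,3) len_pos[OF assms(2)] by (auto intro: less_imp_le)
  have mem: "0 \<in> ?S" "len e \<in> ?S" by auto
  obtain n :: nat and b where b: "b 0 = 0 \<and> b n = len e \<and> (\<forall>i\<le>n. b i \<in> ?S) \<and>
      (\<forall>i<n. b i < b (Suc i) \<and> (\<forall>x\<in>?S. x \<le> b i \<or> b (Suc i) \<le> x))"
    using strict_partition_containing[OF fin mem S] by (elim exE)
  have "\<exists>k c. \<forall>s. b i \<le> ereal s \<and> ereal s \<le> b (Suc i) \<longrightarrow>
      ?f (on_edge e (ereal s)) = ereal (of_int k * s + c)" if i: "i < n" for i
  proof (intro exI allI impI)
    fix s assume s: "b i \<le> ereal s \<and> ereal s \<le> b (Suc i)"
    have "b i \<in> ?S" "b (Suc i) \<in> ?S" using i b by (simp_all only: Suc_le_eq less_imp_le)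
    then have "0 \<le> ereal s" "ereal s \<le> len e" using s S by (meson order_trans)+
    then have "?f (on_edge e (ereal s)) = ereal (edge_value \<phi> m W e s)"
      by (intro pl_function_on_edge assms) auto
    \<comment> \<open>A kink counts as passed exactly if it is at most \<open>b i\<close>; every
      other kink is at least \<open>b (Suc i)\<close>, hence not to the left of
      \<open>s\<close>.\<close>
    also have "edge_value \<phi> m W e s = of_int (m e + (\<Sum>t | W e t \<noteq> 0 \<and> ereal t \<le> b i. W e t)) * s +
      (\<phi> (tail G e) - (\<Sum>t | W e t \<noteq> 0 \<and> ereal t \<le> b i. of_int (W e t) * t))"
    proof (rule edge_value_affine[OF assms])
      fix t assume t: "W e t \<noteq> 0"
      show "t \<le> s" if "ereal t \<le> b i" using that s by (metis ereal_less_eq(3) order_trans)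
      show "s \<le> t" if "\<not> ereal t \<le> b i"
      proof -
        have "ereal t \<in> ?S" using t by blast
        then have "b (Suc i) \<le> ereal t" using b i that by blast
        then have "ereal s \<le> ereal t" using s by (blast intro: order_trans)
        then show ?thesis by simp
      qed
    qed
    finally show "?f (on_edge e (ereal s)) = ereal (of_int (m e + (\<Sum>t | W e t \<noteq> 0 \<and> ereal t \<le> b i. W e t)) * s +
      (\<phi> (tail G e) - (\<Sum>t | W e t \<noteq> 0 \<and> ereal t \<le> b i. of_int (W e t) * t)))" .
  qed
  with b show ?thesis unfolding pl_on_edge_def by (intro exI[of _ n] exI[of _ b] conjI allI impI) simp_all
qed

text \<open>Up to a finite parameter this is the continuity of the real edge formula. Beyond the
  last kink of an infinite edge the function is affine as an extended real expression, and
  multiplication by a finite constant is continuous even at \<infinity>.\<close>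

lemma continuous_on_edge_pl_function:
  assumes "pl_data \<phi> m W" "e \<in> arcs G"
  shows "continuous_on {0..len e} (\<lambda>t. pl_function \<phi> m W (on_edge e t))"
proof -
  let ?f = "\<lambda>t. pl_function \<phi> m W (on_edge e t)"
  have finite_part: "continuous_on {0..ereal l} ?f" if "ereal l \<le> len e" for l
  proof -
    have cont: "continuous_on {0..ereal l} (\<lambda>t. ereal (edge_value \<phi> m W e (real_of_ereal t)))"
    proof (rule continuous_on_ereal, rule continuous_on_compose2[of UNIV "edge_value \<phi> m W e"])
      show "continuous_on UNIV (edge_value \<phi> m W e)"
        unfolding edge_value_def [abs_def] by (intro continuous_intros continuous_on_hinges)
      show "continuous_on {0..ereal l} real_of_ereal"
        by (rule continuous_on_subset[OF continuous_on_real]) auto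
    qed auto
    have eq: "?f t = ereal (edge_value \<phi> m W e (real_of_ereal t))" if t: "t \<in> {0..ereal l}" for t
    proof -
      obtain r where r: "t = ereal r" using t by (cases t) simp_all
      then show ?thesis
        using t \<open>ereal l \<le> len e\<close> pl_function_on_edge[OF assms, of r]
        by (metis atLeastAtMost_iff ereal_less_eq(5) order_trans real_of_ereal.simps(1))
    qed
    show ?thesis by (rule continuous_on_eq[OF cont eq[symmetric]])
  qed
  show ?thesis
  proof (cases "len e")
    case (real l)
    then show ?thesis using finite_part[of l] by simp
  next
    case PInf
    \<comment> \<open>Inserting 0 keeps the maximum meaningful on an edge without kinks and gives
      \<open>0 \<le> l\<close>.\<close>
    define l where "l = Max (insert 0 {t. W e t \<noteq> 0})"
    have l: "0 \<le> l" "\<And>t. W e t \<noteq> 0 \<Longrightarrow> t \<le> l"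
      unfolding l_def using pl_dataD(1)[OF assms] by auto
    let ?c = "\<phi> (tail G e) - (\<Sum>t | W e t \<noteq> 0. of_int (W e t) * t)"
    have eq: "?f t = ereal (of_int (final_slope m W e)) * t + ereal ?c" if "t \<in> {ereal l..\<infinity>}" for t
    proof (cases t)
      case (real r)
      have "t' \<le> r" if "W e t' \<noteq> 0" for t'
        using l(2)[OF that] \<open>t \<in> _\<close> real by simp
      then have "edge_value \<phi> m W e r = of_int (final_slope m W e) * r + ?c"
        unfolding final_slope_def using edge_value_affine[OF assms, of "\<lambda>_. True" r] by simp
      then show ?thesis
        using real that l(1) PInf pl_function_on_edge[OF assms, of r] by simp
    next
      case PInf
      then show ?thesis using pl_function_on_edge_infinity[OF assms(2)] \<open>len e = \<infinity>\<close> by simp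
    next
      case MInf
      then show ?thesis using that by simp
    qed
    have cont: "continuous_on {ereal l..\<infinity>} (\<lambda>t. ereal (of_int (final_slope m W e)) * t + ereal ?c)"
      unfolding continuous_on_def
    proof
      fix t
      have "((\<lambda>t. ereal (of_int (final_slope m W e)) * t) \<longlongrightarrow> ereal (of_int (final_slope m W e)) * t)
          (at t within {ereal l..\<infinity>})"
        by (rule tendsto_cmult_ereal) (simp_all add: tendsto_ident_at)
      then show "((\<lambda>t. ereal (of_int (final_slope m W e)) * t + ereal ?c) \<longlongrightarrow>
          ereal (of_int (final_slope m W e)) * t + ereal ?c) (at t within {ereal l..\<infinity>})"
        by (intro tendsto_add_ereal_general1[OF _ _ tendsto_const]) simp_all
    qed
    have "continuous_on {ereal l..\<infinity>} ?f" by (rule continuous_on_eq[OF cont eq[symmetric]])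
    moreover have "continuous_on {0..ereal l} ?f" using finite_part PInf by simp
    moreover have "{0..len e} = {0..ereal l} \<union> {ereal l..\<infinity>}"
      using l(1) ivl_disj_un_two_touch(4)[of 0 "ereal l" \<infinity>] unfolding PInf by simp
    ultimately show ?thesis by (metis closed_atLeastAtMost continuous_on_closed_Un)
  next
    case MInf
    then show ?thesis by simp
  qed
qed

text \<open>Openness in the quotient topology is tested edge by edge, so continuity reduces to the
  closed edges.\<close>

lemma rational_function_pl_function:
  assumes "pl_data \<phi> m W"
  shows "rational_function (pl_function \<phi> m W)"
  unfolding rational_function_def
proof (intro conjI ballI)
  show "continuous_map curve_topology euclidean (pl_function \<phi> m W)"
    unfolding continuous_map_def openin_curve_topology topspace_curve_topology curve_open_def
  proof (intro conjI allI impI ballI)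
    fix U :: "ereal set" and e assume U: "openin euclidean U" and e: "e \<in> arcs G"
    have "{t \<in> {0..len e}. on_edge e t \<in> {x \<in> points. pl_function \<phi> m W x \<in> U}} =
        {0..len e} \<inter> (\<lambda>t. pl_function \<phi> m W (on_edge e t)) -` U"
      using on_edge_in_points[OF e] by auto
    then show "openin (top_of_set {0..len e})
        {t \<in> {0..len e}. on_edge e t \<in> {x \<in> points. pl_function \<phi> m W x \<in> U}}"
      using continuous_openin_preimage_gen[OF continuous_on_edge_pl_function[OF assms e]] U by simp
  qed auto
  fix x assume "x \<in> points - points_at_infinity"
  then have "\<not> at_infinity v" if "x = Vertex v" for v using that by simp
  then show "\<bar>pl_function \<phi> m W x\<bar> \<noteq> \<infinity>" by (cases x) (simp_all add: pl_function_def)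
qed (rule pl_on_edge_pl_function[OF assms])

section \<open>Slopes and orders of piecewise linear functions\<close>

text \<open>There are finitely many kinks, so a short open interval to the right of \<open>t\<close>
  contains none. A kink at \<open>t\<close> itself has been passed, whence the non-strict
  bound.\<close>

lemma right_slope_pl_function:
  assumes "pl_data \<phi> m W" "e \<in> arcs G" "0 \<le> t" "ereal t < len e"
  shows "right_slope (pl_function \<phi> m W) e (ereal t) = m e + (\<Sum>s | W e s \<noteq> 0 \<and> s \<le> t. W e s)"
proof (rule right_slope_eqI)
  let ?T = "{s. W e s \<noteq> 0}"
  have "\<forall>\<^sub>F s in at_right (ereal t). \<forall>u\<in>?T. t < u \<longrightarrow> s < ereal u"
    using pl_dataD(1)[OF assms(1,2)]
  proof (intro eventually_ball_finite ballI)
    show "\<forall>\<^sub>F s in at_right (ereal t). t < u \<longrightarrow> s < ereal u" for u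
      using eventually_at_right_Ioo[of "ereal t" "ereal u"]
      by (cases "t < u") (auto elim: eventually_mono)
  qed
  then show "\<forall>\<^sub>F s in at_right (ereal t). pl_function \<phi> m W (on_edge e s) =
      ereal (of_int (m e + (\<Sum>s | W e s \<noteq> 0 \<and> s \<le> t. W e s)) * real_of_ereal s +
        (\<phi> (tail G e) - (\<Sum>s | W e s \<noteq> 0 \<and> s \<le> t. of_int (W e s) * s)))"
    using eventually_at_right_Ioo[OF assms(4)]
  proof eventually_elim
    case (elim s)
    then obtain r where r: "s = ereal r" by (cases s) auto
    have "edge_value \<phi> m W e r = of_int (m e + (\<Sum>s | W e s \<noteq> 0 \<and> s \<le> t. W e s)) * r +
        (\<phi> (tail G e) - (\<Sum>s | W e s \<noteq> 0 \<and> s \<le> t. of_int (W e s) * s))"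
    proof (rule edge_value_affine[OF assms(1,2)])
      fix u assume u: "W e u \<noteq> 0"
      show "u \<le> r" if "u \<le> t" using that elim(2) r by simp
      show "r \<le> u" if "\<not> u \<le> t" using that u elim(1) r by (simp add: less_imp_le)
    qed
    moreover have "pl_function \<phi> m W (on_edge e (ereal r)) = ereal (edge_value \<phi> m W e r)"
      using elim(2) r assms(3) by (intro pl_function_on_edge[OF assms(1,2)]) auto
    ultimately show ?case using r by simp
  qed
qed (use assms in auto)

text \<open>A kink at \<open>t\<close> has not been passed yet, whence the strict bound. Here
  \<open>t\<close> is an extended real, because the slope at the infinite end of an edge is wanted
  too.\<close>

lemma left_slope_pl_function:
  assumes "pl_data \<phi> m W" "e \<in> arcs G" "0 < t" "t \<le> len e"
  shows "left_slope (pl_function \<phi> m W) e t = m e + (\<Sum>s | W e s \<noteq> 0 \<and> ereal s < t. W e s)"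
proof (rule left_slope_eqI)
  let ?T = "{s. W e s \<noteq> 0}"
  have "\<forall>\<^sub>F s in at_left t. \<forall>u\<in>?T. ereal u < t \<longrightarrow> ereal u < s"
    using pl_dataD(1)[OF assms(1,2)]
  proof (intro eventually_ball_finite ballI)
    show "\<forall>\<^sub>F s in at_left t. ereal u < t \<longrightarrow> ereal u < s" for u
      using eventually_at_left_Ioo[of "ereal u" t]
      by (cases "ereal u < t") (auto elim: eventually_mono)
  qed
  then show "\<forall>\<^sub>F s in at_left t. pl_function \<phi> m W (on_edge e s) =
      ereal (of_int (m e + (\<Sum>s | W e s \<noteq> 0 \<and> ereal s < t. W e s)) * real_of_ereal s +
        (\<phi> (tail G e) - (\<Sum>s | W e s \<noteq> 0 \<and> ereal s < t. of_int (W e s) * s)))"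
    using eventually_at_left_Ioo[OF assms(3)]
  proof eventually_elim
    case (elim s)
    then obtain r where r: "s = ereal r" by (cases s) auto
    have "edge_value \<phi> m W e r = of_int (m e + (\<Sum>s | W e s \<noteq> 0 \<and> ereal s < t. W e s)) * r +
        (\<phi> (tail G e) - (\<Sum>s | W e s \<noteq> 0 \<and> ereal s < t. of_int (W e s) * s))"
    proof (rule edge_value_affine[OF assms(1,2)])
      fix u assume u: "W e u \<noteq> 0"
      show "u \<le> r" if "ereal u < t" using that u elim(1) r by (simp add: less_imp_le)
      show "r \<le> u" if "\<not> ereal u < t"
        using that elim(2) r by (metis ereal_less_eq(3) less_imp_le not_less order_trans)
    qed
    moreover have "pl_function \<phi> m W (on_edge e (ereal r)) = ereal (edge_value \<phi> m W e r)"
    proof (rule pl_function_on_edge[OF assms(1,2)])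
      show "0 \<le> r" using elim(2) r by simp
      show "ereal r \<le> len e" using elim(2) r assms(4) by (metis less_imp_le order_trans)
    qed
    ultimately show ?case using r by simp
  qed
qed (rule assms)

lemma ord_at_Inner_pl_function:
  assumes "pl_data \<phi> m W" "e \<in> arcs G" "0 < t" "ereal t < len e"
  shows "ord_at (pl_function \<phi> m W) (Inner e t) = W e t"
proof -
  have "{s. W e s \<noteq> 0 \<and> s \<le> t} = {s. W e s \<noteq> 0 \<and> s < t} \<union> {s. W e s \<noteq> 0 \<and> s = t}" by auto
  then have "(\<Sum>s | W e s \<noteq> 0 \<and> s \<le> t. W e s) =
      (\<Sum>s | W e s \<noteq> 0 \<and> s < t. W e s) + (\<Sum>s | W e s \<noteq> 0 \<and> s = t. W e s)"
    using pl_dataD(1)[OF assms(1,2)] by (simp add: sum.union_disjoint disjoint_iff)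
  also have "{s. W e s \<noteq> 0 \<and> s = t} = (if W e t = 0 then {} else {t})" by auto
  finally show ?thesis
    using assms right_slope_pl_function[OF assms(1,2)] left_slope_pl_function[OF assms(1,2)]
    by simp
qed

text \<open>All kinks are interior: none has been passed at the tail, and all have been passed at
  the head.\<close>

lemma ord_at_Vertex_pl_function:
  assumes "pl_data \<phi> m W"
  shows "ord_at (pl_function \<phi> m W) (Vertex v) = vertex_ord m W v"
proof -
  have "right_slope (pl_function \<phi> m W) e 0 = m e" if "e \<in> arcs G" for e
  proof -
    have "(\<Sum>s | W e s \<noteq> 0 \<and> s \<le> 0. W e s) = 0"
      by (rule sum.neutral) (use pl_dataD(2)[OF assms that] in force)
    then show ?thesis
      using right_slope_pl_function[OF assms that, of 0] len_pos[OF that]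
      by (simp flip: zero_ereal_def)
  qed
  moreover have "left_slope (pl_function \<phi> m W) e (len e) = final_slope m W e" if "e \<in> arcs G" for e
  proof -
    have "{s. W e s \<noteq> 0 \<and> ereal s < len e} = {s. W e s \<noteq> 0}" using pl_dataD(3)[OF assms that] by auto
    then show ?thesis
      using left_slope_pl_function[OF assms that, of "len e"] len_pos[OF that]
      by (simp add: final_slope_def)
  qed
  ultimately show ?thesis by (simp add: vertex_ord_def sum_negf)
qed

text \<open>Reduces membership in \<open>R D\<close> to inequalities between integers, the slopes
  and the kinks.\<close>

lemma pl_function_in_R:
  assumes "pl_data \<phi> m W"
    and "\<And>v. v \<in> verts G \<Longrightarrow> 0 \<le> D (Vertex v) + vertex_ord m W v"
    and "\<And>e t. e \<in> arcs G \<Longrightarrow> 0 < t \<Longrightarrow> ereal t < len e \<Longrightarrow> 0 \<le> D (Inner e t) + W e t"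
  shows "pl_function \<phi> m W \<in> R D"
  unfolding R_def
  using rational_function_pl_function[OF assms(1)] assms(2,3) ord_at_Inner_pl_function[OF assms(1)]
  by (auto simp: points_def ord_at_Vertex_pl_function[OF assms(1)] simp del: ord_at.simps)

section \<open>Sums of piecewise linear functions\<close>

lemma final_slope_add:
  assumes "finite {t. W e t \<noteq> 0}" "finite {t. W' e t \<noteq> 0}"
  shows "final_slope (\<lambda>e. m e + m' e) (\<lambda>e t. W e t + W' e t) e = final_slope m W e + final_slope m' W' e"
proof -
  let ?T = "{t. W e t \<noteq> 0} \<union> {t. W' e t \<noteq> 0}"
  have T: "(\<Sum>t | w t \<noteq> 0. w t) = (\<Sum>t\<in>?T. w t)" if "{t. w t \<noteq> 0} \<subseteq> ?T" for w :: "real \<Rightarrow> int"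
    using that assms by (intro sum.mono_neutral_left) auto
  show ?thesis
    unfolding final_slope_def
    by (subst (1 2 3) T) (auto simp: sum.distrib)
qed

lemma edge_value_add:
  assumes "finite {t. W e t \<noteq> 0}" "finite {t. W' e t \<noteq> 0}"
  shows "edge_value (\<lambda>v. \<phi> v + \<phi>' v) (\<lambda>e. m e + m' e) (\<lambda>e t. W e t + W' e t) e s =
    edge_value \<phi> m W e s + edge_value \<phi>' m' W' e s"
  unfolding edge_value_def using hinges_add[OF assms] by (simp add: algebra_simps)

lemma pl_data_add:
  assumes "pl_data \<phi> m W" "pl_data \<phi>' m' W'"
  shows "pl_data (\<lambda>v. \<phi> v + \<phi>' v) (\<lambda>e. m e + m' e) (\<lambda>e t. W e t + W' e t)"
  unfolding pl_data_def
proof (intro ballI conjI allI impI)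
  fix e assume e: "e \<in> arcs G"
  note D = pl_dataD[OF assms(1) e] pl_dataD[OF assms(2) e]
  show "finite {t. W e t + W' e t \<noteq> 0}"
    by (rule finite_subset[of _ "{t. W e t \<noteq> 0} \<union> {t. W' e t \<noteq> 0}"]) (use D(1,5) in auto)
  fix t assume "W e t + W' e t \<noteq> 0"
  then have "W e t \<noteq> 0 \<or> W' e t \<noteq> 0" by auto
  then show "0 < t" "ereal t < len e" using D(2,3,6,7) by blast+
next
  fix e l assume e: "e \<in> arcs G" and l: "len e = ereal l"
  note D = pl_dataD[OF assms(1) e] pl_dataD[OF assms(2) e]
  show "edge_value (\<lambda>v. \<phi> v + \<phi>' v) (\<lambda>e. m e + m' e) (\<lambda>e t. W e t + W' e t) e l = \<phi> (head G e) + \<phi>' (head G e)"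
    using edge_value_add[where W = W and W' = W', OF D(1,5)] D(4,8) l by simp
qed

lemma vertex_ord_add:
  assumes "pl_data \<phi> m W" "pl_data \<phi>' m' W'"
  shows "vertex_ord (\<lambda>e. m e + m' e) (\<lambda>e t. W e t + W' e t) v = vertex_ord m W v + vertex_ord m' W' v"
proof -
  have "(\<Sum>e\<in>in_arcs G v. final_slope (\<lambda>e. m e + m' e) (\<lambda>e t. W e t + W' e t) e) =
      (\<Sum>e\<in>in_arcs G v. final_slope m W e + final_slope m' W' e)"
    using assms by (intro sum.cong final_slope_add) (auto simp: pl_data_def)
  then show ?thesis unfolding vertex_ord_def by (simp add: sum.distrib)
qed

text \<open>The second summand is itself the difference, so it is known to be rational and has
  definite values at infinity, where a literal subtraction could meet \<infinity> -
  \<infinity>.\<close>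

lemma is_difference_pl_function_add:
  assumes "pl_data \<phi> m W" "pl_data \<phi>' m' W'"
  shows "is_difference (pl_function \<phi>' m' W')
    (pl_function (\<lambda>v. \<phi> v + \<phi>' v) (\<lambda>e. m e + m' e) (\<lambda>e t. W e t + W' e t)) (pl_function \<phi> m W)"
  unfolding is_difference_def
proof (intro conjI ballI rational_function_pl_function assms)
  fix x assume "x \<in> points - points_at_infinity"
  then consider v where "x = Vertex v" "\<not> at_infinity v"
    | e t where "x = Inner e t" "e \<in> arcs G"
    by (auto simp: points_def)
  then show "pl_function \<phi>' m' W' x = pl_function (\<lambda>v. \<phi> v + \<phi>' v) (\<lambda>e. m e + m' e)
      (\<lambda>e t. W e t + W' e t) x - pl_function \<phi> m W x"
  proof cases
    case 1
    then show ?thesis by (simp add: pl_function_def)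
  next
    case 2
    then show ?thesis
      using edge_value_add[where W = W and W' = W', OF pl_dataD(1)[OF assms(1)] pl_dataD(1)[OF assms(2)]]
      by (simp add: pl_function_def)
  qed
qed

section \<open>Counting over arcs, and degrees of divisors\<close>

lemma sum_out_arcs_verts:
  fixes f :: "'e \<Rightarrow> 'b::comm_monoid_add"
  shows "(\<Sum>v\<in>verts G. \<Sum>e\<in>out_arcs G v. f e) = (\<Sum>e\<in>arcs G. f e)"
  unfolding out_arcs_def by (rule sum.group) auto

lemma sum_in_arcs_verts:
  fixes f :: "'e \<Rightarrow> 'b::comm_monoid_add"
  shows "(\<Sum>v\<in>verts G. \<Sum>e\<in>in_arcs G v. f e) = (\<Sum>e\<in>arcs G. f e)"
  unfolding in_arcs_def by (rule sum.group) auto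

lemma divisor_Inner:
  assumes "divisor D"
  shows "finite {t. D (Inner e t) \<noteq> 0}"
    and "D (Inner e t) \<noteq> 0 \<Longrightarrow> e \<in> arcs G \<and> 0 < t \<and> ereal t < len e"
proof -
  have fin: "finite {x. D x \<noteq> 0}" and sub: "{x. D x \<noteq> 0} \<subseteq> points"
    using assms by (auto simp: divisor_def)
  show "finite {t. D (Inner e t) \<noteq> 0}"
    using finite_vimageI[OF fin, of "Inner e"] by (simp add: vimage_def inj_def)
  show "e \<in> arcs G \<and> 0 < t \<and> ereal t < len e" if "D (Inner e t) \<noteq> 0"
    using sub that by (auto simp: points_def)
qed

text \<open>The bound \<open>2 |E| + 2\<close> dominates the valence of every point of the curve.\<close>

definition separating_data ::
    "('v, 'e) point \<Rightarrow> ('v, 'e) point \<Rightarrow> ('v \<Rightarrow> real) \<Rightarrow> ('e \<Rightarrow> int) \<Rightarrow> ('e \<Rightarrow> real \<Rightarrow> int) \<Rightarrow> bool" where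
  "separating_data x x' \<phi> m W \<longleftrightarrow>
     pl_data \<phi> m W \<and> pl_function \<phi> m W x \<noteq> pl_function \<phi> m W x' \<and>
     (\<forall>v\<in>verts G. 0 \<le> vertex_ord m W v + (if x = Vertex v then 2 * int (card (arcs G)) + 2 else 0)) \<and>
     (\<forall>e t. 0 \<le> W e t + (if x = Inner e t then 2 * int (card (arcs G)) + 2 else 0))"

lemma degree_eq:
  assumes "divisor D"
  shows "degree D = (\<Sum>v\<in>verts G. D (Vertex v)) +
    (\<Sum>e\<in>arcs G. \<Sum>t | D (Inner e t) \<noteq> 0. D (Inner e t))"
proof -
  let ?T = "\<lambda>e. {t. D (Inner e t) \<noteq> 0}"
  have sub: "{x. D x \<noteq> 0} \<subseteq> points"
    using assms by (auto simp: divisor_def)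
  have finT: "finite (?T e)" for e by (rule divisor_Inner(1)[OF assms])
  have "degree D = sum D (Vertex ` verts G \<union> (\<Union>e\<in>arcs G. Inner e ` ?T e))"
    unfolding degree_def using sub finT
    by (intro sum.mono_neutral_left) (auto simp: points_def)
  also have "\<dots> = sum D (Vertex ` verts G) + sum D (\<Union>e\<in>arcs G. Inner e ` ?T e)"
    using finT by (intro sum.union_disjoint) auto
  also have "sum D (\<Union>e\<in>arcs G. Inner e ` ?T e) = (\<Sum>e\<in>arcs G. sum D (Inner e ` ?T e))"
    using finT by (intro sum.UNION_disjoint) auto
  finally show ?thesis by (simp add: sum.reindex inj_on_def)
qed

lemma degree_combination:
  assumes "divisor D" "divisor D'"
  shows "divisor (\<lambda>x. a * D x + b * D' x)"
    and "degree (\<lambda>x. a * D x + b * D' x) = a * degree D + b * degree D'"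
proof -
  let ?S = "{x. D x \<noteq> 0} \<union> {x. D' x \<noteq> 0}"
  have fin: "finite ?S" using assms by (auto simp: divisor_def)
  have sub: "{x. a * D x + b * D' x \<noteq> 0} \<subseteq> ?S" by auto
  show "divisor (\<lambda>x. a * D x + b * D' x)"
    unfolding divisor_def using finite_subset[OF sub fin] sub assms by (auto simp: divisor_def)
  have deg: "degree E = sum E ?S" if "{x. E x \<noteq> 0} \<subseteq> ?S" for E
    unfolding degree_def using that fin by (intro sum.mono_neutral_left) auto
  show "degree (\<lambda>x. a * D x + b * D' x) = a * degree D + b * degree D'"
    by (subst (1 2 3) deg) (auto simp: sum.distrib sum_distrib_left)
qed

lemma pl_function_at_infinity:
  assumes "e \<in> arcs G" "len e = \<infinity>"
  shows "pl_function \<phi> m W (Vertex (head G e)) = ereal (of_int (final_slope m W e)) * \<infinity> +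
            ereal (\<phi> (tail G e) - (\<Sum>t | W e t \<noteq> 0. of_int (W e t) * t))"
  using pl_function_on_edge_infinity[OF assms] assms(2) by (simp add: on_edge_def)

lemma final_slope_superset:
  assumes "finite T" "{t. W e t \<noteq> 0} \<subseteq> T"
  shows "final_slope m W e = m e + (\<Sum>t\<in>T. W e t)"
  unfolding final_slope_def using sum.mono_neutral_left[OF assms, of "W e"] by simp

lemma pl_function_at_infinity_superset:
  assumes "e \<in> arcs G" "len e = \<infinity>" "finite T" "{t. W e t \<noteq> 0} \<subseteq> T"
  shows "pl_function \<phi> m W (Vertex (head G e)) = ereal (of_int (m e + (\<Sum>t\<in>T. W e t))) * \<infinity> +
            ereal (\<phi> (tail G e) - (\<Sum>t\<in>T. of_int (W e t) * t))"
proof -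
  have "(\<Sum>t | W e t \<noteq> 0. of_int (W e t) * t) = (\<Sum>t\<in>T. of_int (W e t) * t)"
    using assms(3,4) by (intro sum.mono_neutral_left) auto
  then show ?thesis
    by (simp only: pl_function_at_infinity[OF assms(1,2)] final_slope_superset[where W = W, OF assms(3,4)])
qed

section \<open>Tent functions separating points\<close>

text \<open>A tent of height \<open>\<epsilon>\<close> with kinks 1, -2, 1: a double pole at
  \<open>t0\<close>, simple zeros at the feet, order 0 at all vertices. It is so narrow that it
  stays inside the edge and vanishes at \<open>x'\<close>.\<close>

lemma separating_data_Inner:
  assumes x: "Inner e0 t0 \<in> points" and x': "x' \<in> points" "x' \<noteq> Inner e0 t0"
  shows "\<exists>\<phi> m W. separating_data (Inner e0 t0) x' \<phi> m W"
proof -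
  have e0: "e0 \<in> arcs G" "0 < t0" "ereal t0 < len e0" using x by (auto simp: points_def)
  \<comment> \<open>A real stand-in for the length of the edge, which may be \<infinity>.\<close>
  obtain r where r: "t0 < r" "ereal r \<le> len e0"
  proof (cases "len e0")
    case PInf
    then show thesis using that[of "t0 + 1"] by simp
  qed (use that e0 in auto)
  \<comment> \<open>Only a point on the same edge restricts the width; at any other point the tent
    vanishes anyway, and 1 is a placeholder.\<close>
  define d where "d = (case x' of Inner e t \<Rightarrow> (if e = e0 then \<bar>t - t0\<bar> else 1) | _ \<Rightarrow> 1)"
  have "0 < d" using x' by (auto simp: d_def split: point.splits)
  define \<epsilon> where "\<epsilon> = min d (min t0 (r - t0)) / 2"
  have \<epsilon>: "0 < \<epsilon>" "\<epsilon> < d" "\<epsilon> < t0" "t0 + \<epsilon> < r"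
    using \<open>0 < d\<close> e0 r unfolding \<epsilon>_def by (auto simp: min_def field_simps)
  define W :: "'e \<Rightarrow> real \<Rightarrow> int" where
    "W e t = (if e = e0 then of_bool (t = t0 - \<epsilon>) - 2 * of_bool (t = t0) + of_bool (t = t0 + \<epsilon>) else 0)" for e t
  define T where "T = {t0 - \<epsilon>, t0, t0 + \<epsilon>}"
  have T: "finite T" "{t. W e t \<noteq> 0} \<subseteq> T" for e
    by (auto simp: T_def W_def split: if_splits)
  have WT: "(\<Sum>t\<in>T. of_int (W e t) * g t) = (if e = e0 then g (t0 - \<epsilon>) - 2 * g t0 + g (t0 + \<epsilon>) else 0)"
    for e and g :: "real \<Rightarrow> real"
    using \<epsilon>(1) by (simp add: T_def W_def)
  have WT': "(\<Sum>t\<in>T. W e t) = 0" for e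
    using \<epsilon>(1) by (simp add: T_def W_def)
  let ?f = "pl_function (\<lambda>_. 0) (\<lambda>_. 0) W"
  have val: "edge_value (\<lambda>_. 0) (\<lambda>_. 0) W e s =
      (if e = e0 then max 0 (s - (t0 - \<epsilon>)) - 2 * max 0 (s - t0) + max 0 (s - (t0 + \<epsilon>)) else 0)" for e s
    by (simp add: edge_value_def hinges_superset[OF T] WT)
  have slope: "final_slope (\<lambda>_. 0) W e = 0" for e
    using final_slope_superset[where W = W, OF T] WT' by simp
  have inside: "0 < t \<and> ereal t < len e" if "W e t \<noteq> 0" for e t
  proof -
    have "e = e0" "t \<in> T" using that T(2)[of e] by (auto simp: W_def split: if_splits)
    moreover have "0 < t \<and> t < r" if "t \<in> T" using that \<epsilon> r e0 by (auto simp: T_def)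
    ultimately show ?thesis using r(2) by (metis less_ereal.simps(1) less_le_trans)
  qed
  have "pl_data (\<lambda>_. 0) (\<lambda>_. 0) W"
    unfolding pl_data_def
  proof (intro ballI conjI allI impI)
    fix e l assume "e \<in> arcs G" "len e = ereal l"
    then show "edge_value (\<lambda>_. 0) (\<lambda>_. 0) W e l = 0"
      unfolding val using r(2) \<epsilon> by auto
  qed (use finite_subset[OF T(2,1)] inside in auto)
  moreover have "?f (Inner e0 t0) = ereal \<epsilon>" using \<epsilon> by (simp add: pl_function_def val)
  moreover have "?f x' = 0"
  proof (cases x')
    case (Vertex v)
    show ?thesis
    proof (cases "at_infinity v")
      case True
      then obtain e where e: "e \<in> arcs G" "len e = \<infinity>" "v = head G e" by (auto simp: at_infinity_def)
      \<comment> \<open>On \<open>e0\<close> the kinks contribute the final slope 1 - 2 + 1 and the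
        constant term \<open>(t0 - \<epsilon>) - 2 * t0 + (t0 + \<epsilon>)\<close> up to sign; both
        vanish.\<close>
      show ?thesis
        unfolding Vertex e(3) pl_function_at_infinity_superset[where W = W, OF e(1,2) T] WT WT' by simp
    qed (simp add: Vertex pl_function_def)
  next
    case (Inner e t)
    then have "e = e0 \<Longrightarrow> \<epsilon> < \<bar>t - t0\<bar>" using \<epsilon>(2) by (simp add: d_def)
    then show ?thesis using Inner \<epsilon>(1) by (auto simp: pl_function_def val max_def abs_if split: if_splits)
  qed
  ultimately have "separating_data (Inner e0 t0) x' (\<lambda>_. 0) (\<lambda>_. 0) W"
    using \<epsilon>(1) by (auto simp: separating_data_def vertex_ord_def slope W_def)
  then show ?thesis by blast
qed

text \<open>The function is zero except beyond the parameter \<open>a\<close> of the infinite edge,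
  where it grows with slope 1 to the value \<infinity>. The outgoing slope at the infinite end is
  -1, a simple pole.\<close>

lemma separating_data_infinite:
  assumes x: "at_infinity v" and x': "x' \<in> points" "x' \<noteq> Vertex v"
  shows "\<exists>\<phi> m W. separating_data (Vertex v) x' \<phi> m W"
proof -
  obtain e0 where e0: "e0 \<in> arcs G" "len e0 = \<infinity>" "v = head G e0" using x by (auto simp: at_infinity_def)
  \<comment> \<open>The kink is not before the parameter of an interior \<open>x'\<close>, on
    whichever edge this lies; the maximum with 1 keeps it away from the tail.\<close>
  define a where "a = (case x' of Inner e t \<Rightarrow> max 1 t | _ \<Rightarrow> 1)"
  have a: "0 < a" by (auto simp: a_def split: point.splits)
  define W :: "'e \<Rightarrow> real \<Rightarrow> int" where "W e t = (if e = e0 \<and> t = a then 1 else 0)" for e t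
  have T: "finite {a}" "{t. W e t \<noteq> 0} \<subseteq> {a}" for e
    by (auto simp: W_def split: if_splits)
  let ?f = "pl_function (\<lambda>_. 0) (\<lambda>_. 0) W"
  have val: "edge_value (\<lambda>_. 0) (\<lambda>_. 0) W e s = (if e = e0 then max 0 (s - a) else 0)" for e s
    unfolding edge_value_def W_def hinges_single by simp
  have slope: "final_slope (\<lambda>_. 0) W e = of_bool (e = e0)" for e
    using final_slope_superset[where W = W, OF T] by (simp add: W_def)
  have "pl_data (\<lambda>_. 0) (\<lambda>_. 0) W"
    unfolding pl_data_def
  proof (intro ballI conjI allI impI)
    show "finite {t. W e t \<noteq> 0}" for e by (rule finite_subset[OF T(2,1)])
    show "0 < t" "ereal t < len e" if "W e t \<noteq> 0" for e t
      using that a e0 by (auto simp: W_def split: if_splits)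
    show "edge_value (\<lambda>_. 0) (\<lambda>_. 0) W e l = 0" if "len e = ereal l" for e l
      using that e0 by (auto simp: val)
  qed
  moreover have "?f (Vertex v) = \<infinity>"
    unfolding e0(3) pl_function_at_infinity_superset[where W = W, OF e0(1,2) T] by (simp add: W_def)
  moreover have "?f x' = 0"
  proof (cases x')
    case (Vertex v')
    show ?thesis
    proof (cases "at_infinity v'")
      case True
      then obtain e where e: "e \<in> arcs G" "len e = \<infinity>" "v' = head G e" by (auto simp: at_infinity_def)
      then have "e \<noteq> e0" using x'(2) e0(3) Vertex by auto
      then show ?thesis
        unfolding Vertex e(3) pl_function_at_infinity_superset[where W = W, OF e(1,2) T] by (simp add: W_def)
    qed (simp add: Vertex pl_function_def)
  next
    case (Inner e t)
    then show ?thesis by (auto simp: pl_function_def val a_def)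
  qed
  moreover have "0 \<le> vertex_ord (\<lambda>_. 0) W u + (if Vertex v = Vertex u then 2 * int (card (arcs G)) + 2 else 0)" for u
  proof (cases "u = v")
    case True
    then show ?thesis by (simp add: vertex_ord_def slope e0(3) arcs_at_infinite_head[OF e0(1,2)])
  next
    case False
    then have "e0 \<notin> in_arcs G u" using e0(3) by simp
    then have "(\<Sum>e\<in>in_arcs G u. final_slope (\<lambda>_. 0) W e) = 0"
      by (intro sum.neutral) (auto simp: slope)
    then show ?thesis by (simp add: vertex_ord_def)
  qed
  ultimately have "separating_data (Vertex v) x' (\<lambda>_. 0) (\<lambda>_. 0) W"
    by (simp add: separating_data_def W_def)
  then show ?thesis by blast
qed

text \<open>A tent of height \<open>\<epsilon>\<close> over \<open>v\<close>, falling to 0 at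
  distance \<open>\<epsilon>\<close> in every direction. Both ends of a loop at \<open>v\<close>
  carry a part of it, and these parts must not overlap.\<close>

lemma separating_data_Vertex:
  assumes x: "\<not> at_infinity v" and x': "x' \<in> points" "x' \<noteq> Vertex v"
  shows "\<exists>\<phi> m W. separating_data (Vertex v) x' \<phi> m W"
proof -
  \<comment> \<open>The distance of an interior \<open>x'\<close> from the ends of its edge bounds
    the radius of the tent. An infinite end gives no bound, nor does a vertex \<open>x'\<close>;
    both get the placeholder 1.\<close>
  define margin where "margin = (case x' of
      Inner e t \<Rightarrow> min t (if len e = \<infinity> then 1 else real_of_ereal (len e) - t) | _ \<Rightarrow> 1)"
  have margin: "0 < margin"
  proof (cases x')
    case (Inner e t)
    then have "0 < t" "ereal t < len e" using x'(1) by (auto simp: points_def)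
    then show ?thesis using Inner by (cases "len e") (auto simp: margin_def)
  qed (simp add: margin_def)
  \<comment> \<open>A third of the length ensures \<open>2 * \<epsilon> < len e\<close>, which
    separates the two feet on a loop.\<close>
  define third where "third e = (if len e = \<infinity> then 1 else real_of_ereal (len e) / 3)" for e
  have third: "0 < third e" if "e \<in> arcs G" for e
    using len_pos[OF that] by (cases "len e") (auto simp: third_def)
  define \<epsilon> where "\<epsilon> = Min (insert margin (third ` arcs G))"
  have \<epsilon>: "0 < \<epsilon>" "\<epsilon> \<le> margin" "\<And>e. e \<in> arcs G \<Longrightarrow> \<epsilon> \<le> third e"
    using margin third unfolding \<epsilon>_def by auto
  have small: "ereal (2 * \<epsilon>) < len e" if "e \<in> arcs G" for e
    using \<epsilon>(1) \<epsilon>(3)[OF that] len_pos[OF that] by (cases "len e") (auto simp: third_def)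
  \<comment> \<open>The foot of the tent next to the head; meaningful on finite edges only, and
    \<open>w'\<close> excludes the others.\<close>
  define far where "far e = real_of_ereal (len e) - \<epsilon>" for e
  define \<phi> :: "'v \<Rightarrow> real" where "\<phi> u = (if u = v then \<epsilon> else 0)" for u
  define m :: "'e \<Rightarrow> int" where "m e = (if tail G e = v then -1 else 0)" for e
  define w w' :: "'e \<Rightarrow> real \<Rightarrow> int" where
    "w e t = (if tail G e = v \<and> t = \<epsilon> then 1 else 0)" and
    "w' e t = (if (head G e = v \<and> len e \<noteq> \<infinity>) \<and> t = far e then 1 else 0)" for e t
  define W where "W e t = w e t + w' e t" for e t
  have W_eq: "W = (\<lambda>e t. w e t + w' e t)" by (simp add: W_def fun_eq_iff)
  have finw: "finite {t. w e t \<noteq> 0}" for e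
    by (rule finite_subset[of _ "{\<epsilon>}"]) (auto simp: w_def split: if_splits)
  have finw': "finite {t. w' e t \<noteq> 0}" for e
    by (rule finite_subset[of _ "{far e}"]) (auto simp: w'_def split: if_splits)
  have val: "edge_value \<phi> m W e s = \<phi> (tail G e) + of_int (m e) * s +
      (if tail G e = v then max 0 (s - \<epsilon>) else 0) +
      (if head G e = v \<and> len e \<noteq> \<infinity> then max 0 (s - far e) else 0)" for e s
    unfolding edge_value_def W_eq hinges_add[where w = "w e" and w' = "w' e", OF finw finw']
    unfolding w_def w'_def hinges_single by simp
  have slope: "final_slope m W e = (if head G e = v \<and> len e \<noteq> \<infinity> then 1 else 0)" for e
  proof -
    have "final_slope m w e = m e + (\<Sum>t\<in>{\<epsilon>}. w e t)"
      by (rule final_slope_superset) (auto simp: w_def split: if_splits)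
    moreover have "final_slope (\<lambda>_. 0) w' e = 0 + (\<Sum>t\<in>{far e}. w' e t)"
      by (rule final_slope_superset) (auto simp: w'_def split: if_splits)
    moreover have "final_slope m W e = final_slope m w e + final_slope (\<lambda>_. 0) w' e"
      using final_slope_add[of w e w' m "\<lambda>_. 0", OF finw finw'] by (simp add: W_eq)
    ultimately show ?thesis by (simp add: m_def w_def w'_def)
  qed
  have far: "\<epsilon> < far e" "ereal (far e + \<epsilon>) = len e" if "e \<in> arcs G" "len e \<noteq> \<infinity>" for e
  proof -
    have "\<bar>len e\<bar> \<noteq> \<infinity>" using len_pos[OF that(1)] that(2) by auto
    then obtain r where r: "len e = ereal r" by auto
    then show "\<epsilon> < far e" "ereal (far e + \<epsilon>) = len e" using small[OF that(1)] by (simp_all add: far_def)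
  qed
  have "pl_data \<phi> m W"
    unfolding pl_data_def
  proof (intro ballI conjI allI impI)
    fix e assume e: "e \<in> arcs G"
    show "finite {t. W e t \<noteq> 0}"
      by (rule finite_subset[of _ "{t. w e t \<noteq> 0} \<union> {t. w' e t \<noteq> 0}"])
        (use finw finw' in \<open>auto simp: W_def\<close>)
    fix t assume "W e t \<noteq> 0"
    then have "t = \<epsilon> \<or> len e \<noteq> \<infinity> \<and> t = far e"
      by (auto simp: W_def w_def w'_def split: if_splits)
    then have "0 < t \<and> ereal t < len e"
    proof
      assume "t = \<epsilon>"
      moreover have "ereal \<epsilon> < ereal (2 * \<epsilon>)" using \<epsilon>(1) by simp
      ultimately show ?thesis using small[OF e] \<epsilon>(1) by (blast intro: less_trans)
    next
      assume "len e \<noteq> \<infinity> \<and> t = far e"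
      then show ?thesis using far[OF e] \<epsilon>(1) by (metis add_strict_left_mono add.right_neutral less_ereal.simps(1) less_trans)
    qed
    then show "0 < t" "ereal t < len e" by auto
  next
    fix e l assume e: "e \<in> arcs G" and l: "len e = ereal l"
    then have "l = far e + \<epsilon>" using far(2)[OF e] by simp
    then show "edge_value \<phi> m W e l = \<phi> (head G e)"
      unfolding val using far(1)[OF e] \<epsilon>(1) l by (simp add: \<phi>_def m_def)
  qed
  moreover have "pl_function \<phi> m W (Vertex v) = ereal \<epsilon>" using x by (simp add: pl_function_def \<phi>_def)
  moreover have "pl_function \<phi> m W x' = 0"
  proof (cases x')
    case (Vertex v')
    show ?thesis
    proof (cases "at_infinity v'")
      case True
      then obtain e where e: "e \<in> arcs G" "len e = \<infinity>" "v' = head G e" by (auto simp: at_infinity_def)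
      \<comment> \<open>Only the foot near the tail can lie on an infinite edge. If the edge leaves
        \<open>v\<close>, its final slope is -1 + 1 and the constant term is
        \<open>\<epsilon> - \<epsilon>\<close>.\<close>
      have "(\<Sum>t | W e t \<noteq> 0. of_int (W e t) * t) = (\<Sum>t\<in>{\<epsilon>}. of_int (W e t) * t)"
        using e(2) by (intro sum.mono_neutral_left) (auto simp: W_def w_def w'_def split: if_splits)
      then show ?thesis
        using e(2) unfolding Vertex e(3) pl_function_at_infinity[OF e(1,2)] slope
        by (simp add: W_def w_def w'_def \<phi>_def)
    next
      case False
      then show ?thesis using x'(2) Vertex by (simp add: pl_function_def \<phi>_def)
    qed
  next
    case (Inner e t)
    then have e: "e \<in> arcs G" using x'(1) by (auto simp: points_def)
    have "\<epsilon> \<le> t" using \<epsilon>(2) Inner by (simp add: margin_def)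
    moreover have "t \<le> far e" if "len e \<noteq> \<infinity>"
      using \<epsilon>(2) Inner that by (simp add: margin_def far_def)
    ultimately show ?thesis using Inner by (simp add: pl_function_def val \<phi>_def m_def)
  qed
  moreover have "0 \<le> vertex_ord m W u + (if Vertex v = Vertex u then 2 * int (card (arcs G)) + 2 else 0)" for u
  proof (cases "u = v")
    case True
    \<comment> \<open>Each arc adds at most one to the pole through its tail and at most one through
      its head; a loop counts in both sums.\<close>
    have "- int (card (arcs G)) \<le> (\<Sum>e\<in>out_arcs G u. m e)"
    proof -
      have "(\<Sum>e\<in>out_arcs G u. m e) = - int (card (out_arcs G u))"
        using True by (simp add: m_def)
      moreover have "card (out_arcs G u) \<le> card (arcs G)" by (intro card_mono) auto
      ultimately show ?thesis by simp
    qed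
    moreover have "(\<Sum>e\<in>in_arcs G u. final_slope m W e) \<le> int (card (arcs G))"
    proof -
      have "(\<Sum>e\<in>in_arcs G u. final_slope m W e) \<le> (\<Sum>e\<in>in_arcs G u. 1)"
        by (rule sum_mono) (simp add: slope)
      moreover have "card (in_arcs G u) \<le> card (arcs G)" by (intro card_mono) auto
      ultimately show ?thesis by simp
    qed
    ultimately show ?thesis using True by (simp add: vertex_ord_def)
  next
    case False
    have "(\<Sum>e\<in>in_arcs G u. final_slope m W e) = 0"
      using False by (intro sum.neutral) (auto simp: slope)
    moreover have "(\<Sum>e\<in>out_arcs G u. m e) = 0"
      using False by (intro sum.neutral) (auto simp: m_def)
    ultimately show ?thesis by (simp add: vertex_ord_def)
  qed
  ultimately have "separating_data (Vertex v) x' \<phi> m W"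
    using \<epsilon>(1) by (simp add: separating_data_def W_def w_def w'_def)
  then show ?thesis by blast
qed

lemma separating_data_exists:
  assumes "x \<in> points" "x' \<in> points" "x \<noteq> x'"
  shows "\<exists>\<phi> m W. separating_data x x' \<phi> m W"
proof (cases x)
  case (Vertex v)
  then show ?thesis
    using separating_data_Vertex separating_data_infinite assms by (cases "at_infinity v") auto
next
  case (Inner e t)
  then show ?thesis using separating_data_Inner assms by auto
qed

end

section \<open>Connectedness and the Laplacian of the curve\<close>

context tropical_curve
begin

text \<open>Otherwise \<open>A\<close> together with the edges starting in it would be a clopen set,
  neither empty nor the whole curve.\<close>

lemma exists_arc_leaving:
  assumes "A \<subseteq> verts G" "A \<noteq> {}" "A \<noteq> verts G"
  shows "\<exists>e\<in>arcs G. (tail G e \<in> A) \<noteq> (head G e \<in> A)"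
proof (rule ccontr)
  assume "\<not> ?thesis"
  then have iff: "tail G e \<in> A \<longleftrightarrow> head G e \<in> A" if "e \<in> arcs G" for e using that by blast
  define U where "U = points \<inter> {x. case x of Vertex v \<Rightarrow> v \<in> A | Inner e t \<Rightarrow> tail G e \<in> A}"
  have on: "on_edge e t \<in> U \<longleftrightarrow> tail G e \<in> A" if "e \<in> arcs G" "t \<in> {0..len e}" for e t
    using on_edge_in_points[OF that] iff[OF that(1)] by (auto simp: U_def on_edge_def)
  have "{t \<in> {0..len e}. on_edge e t \<in> U} = (if tail G e \<in> A then {0..len e} else {})"
    if "e \<in> arcs G" for e using on[OF that] by auto
  then have "curve_open U" by (auto simp: curve_open_def U_def)
  moreover have "{t \<in> {0..len e}. on_edge e t \<in> points - U} = (if tail G e \<in> A then {} else {0..len e})"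
    if "e \<in> arcs G" for e using on[OF that] on_edge_in_points[OF that] by auto
  then have "curve_open (points - U)" by (auto simp: curve_open_def)
  ultimately have "openin curve_topology U \<and> closedin curve_topology U"
    unfolding closedin_def openin_curve_topology topspace_curve_topology by (auto simp: U_def)
  then have "U = {} \<or> U = points"
    using connected topspace_curve_topology by (metis connected_space_clopen_in)
  moreover obtain a b where "a \<in> A" "b \<in> verts G - A" using assms by blast
  then have "Vertex a \<in> U" "Vertex b \<in> points - U" using assms(1) by (auto simp: U_def points_def)
  ultimately show False by auto
qed

lemma arc_laplacian_solution:
  fixes \<kappa> :: "'b \<Rightarrow> real" and c :: "'a \<Rightarrow> real"
  assumes "\<And>e. e \<in> arcs G \<Longrightarrow> 0 < \<kappa> e" "0 \<le> (\<Sum>v\<in>verts G. c v)"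
  obtains \<phi> :: "'a \<Rightarrow> real" where "\<And>v. v \<in> verts G \<Longrightarrow>
    0 \<le> c v + (\<Sum>e\<in>out_arcs G v. \<kappa> e * (\<phi> (head G e) - \<phi> (tail G e)))
            - (\<Sum>e\<in>in_arcs G v. \<kappa> e * (\<phi> (head G e) - \<phi> (tail G e)))"
proof -
  \<comment> \<open>Each arc counts in both directions, which makes \<open>w\<close> symmetric.
    Parallel arcs add up, and loops affect the diagonal only.\<close>
  define w where "w u v = (\<Sum>e\<in>arcs G. \<kappa> e * of_bool (tail G e = u \<and> head G e = v)) +
      (\<Sum>e\<in>arcs G. \<kappa> e * of_bool (tail G e = v \<and> head G e = u))" for u v
  obtain z where z: "z \<in> verts G" using nonempty by blast
  \<comment> \<open>Lowering \<open>c\<close> at one vertex by the total surplus restores the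
    compatibility condition; the surplus is why the conclusion is an inequality.\<close>
  define c' where "c' = c(z := c z - (\<Sum>v\<in>verts G. c v))"
  have c'le: "c' v \<le> c v" for v using assms(2) by (simp add: c'_def)
  have nonneg: "0 \<le> (\<Sum>e\<in>arcs G. \<kappa> e * of_bool (P e))" for P
    by (intro sum_nonneg mult_nonneg_nonneg) (auto intro: less_imp_le assms(1))
  have "\<exists>\<phi>. \<forall>v\<in>verts G. c' v + (\<Sum>u\<in>verts G. w v u * (\<phi> u - \<phi> v)) = 0"
  proof (rule weighted_laplacian_solution)
    show "0 \<le> w u v" for u v unfolding w_def using nonneg by (intro add_nonneg_nonneg)
    have "sum c' (verts G) = (\<Sum>v\<in>verts G. c v - of_bool (v = z) * sum c (verts G))"
      unfolding c'_def by (intro sum.cong) auto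
    also have "\<dots> = 0" using z by (simp add: sum_subtractf flip: sum_distrib_right)
    finally show "sum c' (verts G) = 0" .
    fix A assume A: "A \<subseteq> verts G" "A \<noteq> {}" "A \<noteq> verts G"
    then obtain e where e: "e \<in> arcs G" "(tail G e \<in> A) \<noteq> (head G e \<in> A)"
      using exists_arc_leaving by blast
    have pos: "0 < (\<Sum>e\<in>arcs G. \<kappa> e * of_bool (P e))" if "P e" for P
      using e(1) that assms(1)
      by (intro sum_pos2[of _ e]) (auto intro: less_imp_le)
    have "0 < w (tail G e) (head G e)" "0 < w (head G e) (tail G e)"
      unfolding w_def by (intro add_pos_nonneg add_nonneg_pos pos nonneg; simp)+
    then show "\<exists>u\<in>A. \<exists>v\<in>verts G - A. 0 < w u v"
      using e(2) tail_in_verts[OF e(1)] head_in_verts[OF e(1)] by blast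
  qed (use nonempty in \<open>auto simp: w_def\<close>)
  then obtain \<phi> where \<phi>: "\<And>v. v \<in> verts G \<Longrightarrow> c' v + (\<Sum>u\<in>verts G. w v u * (\<phi> u - \<phi> v)) = 0"
    by blast
  \<comment> \<open>From \<open>v\<close>, an outgoing arc sees \<open>\<phi>\<close> at its head
    and an incoming arc sees it at its tail; writing the latter as head minus tail produces the
    minus sign.\<close>
  have "(\<Sum>u\<in>verts G. w v u * (\<phi> u - \<phi> v)) =
      (\<Sum>e\<in>out_arcs G v. \<kappa> e * (\<phi> (head G e) - \<phi> (tail G e)))
            - (\<Sum>e\<in>in_arcs G v. \<kappa> e * (\<phi> (head G e) - \<phi> (tail G e)))" if v: "v \<in> verts G" for v
  proof -
    have 1: "(\<Sum>u\<in>verts G. (\<Sum>e\<in>arcs G. \<kappa> e * of_bool (tail G e = v \<and> head G e = u)) * (\<phi> u - \<phi> v)) =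
      (\<Sum>e\<in>out_arcs G v. \<kappa> e * (\<phi> (head G e) - \<phi> (tail G e)))"
    proof -
      have "(\<Sum>u\<in>verts G. (\<Sum>e\<in>arcs G. \<kappa> e * of_bool (tail G e = v \<and> head G e = u)) * (\<phi> u - \<phi> v)) =
        (\<Sum>e\<in>arcs G. \<Sum>u\<in>verts G. \<kappa> e * of_bool (tail G e = v \<and> head G e = u) * (\<phi> u - \<phi> v))"
        unfolding sum_distrib_right by (rule sum.swap)
      also have "\<dots> = (\<Sum>e\<in>arcs G. if tail G e = v then \<kappa> e * (\<phi> (head G e) - \<phi> v) else 0)"
      proof (rule sum.cong)
        fix e assume "e \<in> arcs G"
        have "(\<Sum>u\<in>verts G. \<kappa> e * of_bool (tail G e = v \<and> head G e = u) * (\<phi> u - \<phi> v)) =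
          (\<Sum>u\<in>verts G. if u = head G e then of_bool (tail G e = v) * \<kappa> e * (\<phi> u - \<phi> v) else 0)"
          by (rule sum.cong) auto
        then show "(\<Sum>u\<in>verts G. \<kappa> e * of_bool (tail G e = v \<and> head G e = u) * (\<phi> u - \<phi> v)) =
          (if tail G e = v then \<kappa> e * (\<phi> (head G e) - \<phi> v) else 0)"
          using \<open>e \<in> arcs G\<close> by simp
      qed simp
      also have "\<dots> = (\<Sum>e\<in>out_arcs G v. \<kappa> e * (\<phi> (head G e) - \<phi> v))"
        unfolding out_arcs_def by (simp add: sum.inter_filter)
      finally show ?thesis by simp
    qed
    have 2: "(\<Sum>u\<in>verts G. (\<Sum>e\<in>arcs G. \<kappa> e * of_bool (tail G e = u \<and> head G e = v)) * (\<phi> u - \<phi> v)) =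
      - (\<Sum>e\<in>in_arcs G v. \<kappa> e * (\<phi> (head G e) - \<phi> (tail G e)))"
    proof -
      have "(\<Sum>u\<in>verts G. (\<Sum>e\<in>arcs G. \<kappa> e * of_bool (tail G e = u \<and> head G e = v)) * (\<phi> u - \<phi> v)) =
        (\<Sum>e\<in>arcs G. \<Sum>u\<in>verts G. \<kappa> e * of_bool (tail G e = u \<and> head G e = v) * (\<phi> u - \<phi> v))"
        unfolding sum_distrib_right by (rule sum.swap)
      also have "\<dots> = (\<Sum>e\<in>arcs G. if head G e = v then \<kappa> e * (\<phi> (tail G e) - \<phi> v) else 0)"
      proof (rule sum.cong)
        fix e assume "e \<in> arcs G"
        have "(\<Sum>u\<in>verts G. \<kappa> e * of_bool (tail G e = u \<and> head G e = v) * (\<phi> u - \<phi> v)) =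
          (\<Sum>u\<in>verts G. if u = tail G e then of_bool (head G e = v) * \<kappa> e * (\<phi> u - \<phi> v) else 0)"
          by (rule sum.cong) auto
        then show "(\<Sum>u\<in>verts G. \<kappa> e * of_bool (tail G e = u \<and> head G e = v) * (\<phi> u - \<phi> v)) =
          (if head G e = v then \<kappa> e * (\<phi> (tail G e) - \<phi> v) else 0)"
          using \<open>e \<in> arcs G\<close> by simp
      qed simp
      also have "\<dots> = (\<Sum>e\<in>in_arcs G v. \<kappa> e * (\<phi> (tail G e) - \<phi> v))"
        unfolding in_arcs_def by (simp add: sum.inter_filter)
      finally show ?thesis by (simp add: sum_negf[symmetric] algebra_simps)
    qed
    have "(\<Sum>u\<in>verts G. w v u * (\<phi> u - \<phi> v)) =
       (\<Sum>u\<in>verts G. (\<Sum>e\<in>arcs G. \<kappa> e * of_bool (tail G e = v \<and> head G e = u)) * (\<phi> u - \<phi> v)) +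
       (\<Sum>u\<in>verts G. (\<Sum>e\<in>arcs G. \<kappa> e * of_bool (tail G e = u \<and> head G e = v)) * (\<phi> u - \<phi> v))"
      unfolding w_def by (simp add: distrib_right sum.distrib)
    then show ?thesis unfolding 1 2 by simp
  qed
  then have "0 \<le> c v + (\<Sum>e\<in>out_arcs G v. \<kappa> e * (\<phi> (head G e) - \<phi> (tail G e)))
            - (\<Sum>e\<in>in_arcs G v. \<kappa> e * (\<phi> (head G e) - \<phi> (tail G e)))" if "v \<in> verts G" for v
    using \<phi>[OF that] c'le[of v] that by simp
  then show thesis by (rule that)
qed

section \<open>Making divisors of large degree effective\<close>

lemma equivalent_to_effective:
  assumes D: "divisor D" and deg: "2 * int (card (arcs G)) \<le> degree D"
  obtains \<phi> m W where "pl_data \<phi> m W"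
    and "\<And>v. v \<in> verts G \<Longrightarrow> 0 \<le> D (Vertex v) + vertex_ord m W v"
    and "\<And>e t. 0 \<le> D (Inner e t) + W e t"
proof -
  define a where "a e t = D (Inner e t)" for e t
  \<comment> \<open>Cancelling the interior part of \<open>D\<close> on \<open>e\<close> changes the
    final slope by \<open>- A e\<close> and, on a finite edge, the value at the head by
    \<open>P e - A e * l e\<close>.\<close>
  define A where "A e = (\<Sum>t | a e t \<noteq> 0. a e t)" for e
  define P :: "'b \<Rightarrow> real" where "P e = (\<Sum>t | a e t \<noteq> 0. of_int (a e t) * t)" for e
  \<comment> \<open>Infinite edges get length 1 in the Laplace equation; the inequality at the infinite end makes
    any conductance work.\<close>
  define l where "l e = (if len e = \<infinity> then 1 else real_of_ereal (len e))" for e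
  define B where "B e = P e / l e" for e
  \<comment> \<open>The part of the order at \<open>v\<close> that does not depend on the potential,
    computed with real slopes and diminished by a reserve of one for each end of an arc at
    \<open>v\<close>.\<close>
  define c where "c v = of_int (D (Vertex v)) + (\<Sum>e\<in>out_arcs G v. of_int (A e) - B e - 1)
    + (\<Sum>e\<in>in_arcs G v. B e - 1)" for v
  have fina: "finite {t. a e t \<noteq> 0}" for e unfolding a_def by (rule divisor_Inner(1)[OF D])
  have a: "e \<in> arcs G" "0 < t" "ereal t < len e" if "a e t \<noteq> 0" for e t
    using divisor_Inner(2)[OF D] that unfolding a_def by blast+
  have l_pos: "0 < l e" if "e \<in> arcs G" for e
    using len_pos[OF that] by (cases "len e") (simp_all add: l_def)
  have len_eq: "len e = ereal (l e)" if "e \<in> arcs G" "len e \<noteq> \<infinity>" for e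
  proof -
    have "\<bar>len e\<bar> \<noteq> \<infinity>" using len_pos[OF that(1)] that(2) by auto
    then show ?thesis using that(2) by (simp add: l_def ereal_real')
  qed
  \<comment> \<open>Summed over all vertices, the terms \<open>B e\<close> cancel and each arc costs
    two reserves; this is where the bound on the degree comes from.\<close>
  have "(\<Sum>v\<in>verts G. c v) = (\<Sum>v\<in>verts G. of_int (D (Vertex v))) +
      (\<Sum>e\<in>arcs G. of_int (A e) - B e - 1) + (\<Sum>e\<in>arcs G. B e - 1)"
    unfolding c_def by (simp only: sum.distrib sum_out_arcs_verts sum_in_arcs_verts)
  also have "\<dots> = of_int ((\<Sum>v\<in>verts G. D (Vertex v)) + (\<Sum>e\<in>arcs G. A e)) - 2 * of_nat (card (arcs G))"
    by (simp add: sum_subtractf)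
  also have "\<dots> = of_int (degree D - 2 * int (card (arcs G)))"
    unfolding degree_eq[OF D] A_def a_def by simp
  also have "\<dots> \<ge> 0" using deg by simp
  finally have c0: "0 \<le> (\<Sum>v\<in>verts G. c v)" .
  have "0 < 1 / l e" if "e \<in> arcs G" for e using l_pos[OF that] by simp
  then obtain \<phi> where \<phi>: "\<And>v. v \<in> verts G \<Longrightarrow>
    0 \<le> c v + (\<Sum>e\<in>out_arcs G v. 1 / l e * (\<phi> (head G e) - \<phi> (tail G e)))
            - (\<Sum>e\<in>in_arcs G v. 1 / l e * (\<phi> (head G e) - \<phi> (tail G e)))"
    using arc_laplacian_solution[of "\<lambda>e. 1 / l e" c] c0 by blast
  define \<sigma> where "\<sigma> e = (\<phi> (head G e) - \<phi> (tail G e)) / l e + of_int (A e) - B e" for e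
  have \<sigma>: "0 \<le> of_int (D (Vertex v)) + (\<Sum>e\<in>out_arcs G v. \<sigma> e - 1)
      - (\<Sum>e\<in>in_arcs G v. \<sigma> e - of_int (A e) + 1)" if "v \<in> verts G" for v
  proof -
    have "(\<Sum>e\<in>out_arcs G v. \<sigma> e - 1) = (\<Sum>e\<in>out_arcs G v. of_int (A e) - B e - 1) +
        (\<Sum>e\<in>out_arcs G v. 1 / l e * (\<phi> (head G e) - \<phi> (tail G e)))"
      unfolding sum.distrib[symmetric] by (rule sum.cong) (simp_all add: \<sigma>_def)
    moreover have "(\<Sum>e\<in>in_arcs G v. \<sigma> e - of_int (A e) + 1) =
        (\<Sum>e\<in>in_arcs G v. 1 / l e * (\<phi> (head G e) - \<phi> (tail G e))) - (\<Sum>e\<in>in_arcs G v. B e - 1)"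
      unfolding sum_subtractf[symmetric] by (rule sum.cong) (simp_all add: \<sigma>_def)
    ultimately show ?thesis using \<phi>[OF that] by (simp only: c_def)
  qed
  \<comment> \<open>On an infinite edge no head value has to be met, and the slope is chosen so that
    the order at the infinite end cancels \<open>D\<close> there exactly.\<close>
  define m where "m e = (if len e = \<infinity> then A e + D (Vertex (head G e)) else \<lfloor>\<sigma> e\<rfloor>)" for e
  \<comment> \<open>Raising the slope by one at \<open>u e\<close> makes up for the fractional part of \<open>\<sigma> e\<close>.\<close>
  define u where "u e = l e * (1 - (\<sigma> e - of_int \<lfloor>\<sigma> e\<rfloor>))" for e
  \<comment> \<open>For integral \<open>\<sigma> e\<close> the point \<open>u e\<close> is the head
    itself; then no correction is due and no kink is placed.\<close>
  define w :: "'b \<Rightarrow> real \<Rightarrow> int" where "w e t = (if (len e \<noteq> \<infinity> \<and> u e < l e) \<and> t = u e then 1 else 0)" for e t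
  define W where "W e t = - a e t + w e t" for e t
  have u: "0 < u e" "u e \<le> l e" if "e \<in> arcs G" for e
  proof -
    have "0 < 1 - (\<sigma> e - of_int \<lfloor>\<sigma> e\<rfloor>)" "1 - (\<sigma> e - of_int \<lfloor>\<sigma> e\<rfloor>) \<le> 1" by linarith+
    then show "0 < u e" "u e \<le> l e"
      unfolding u_def using l_pos[OF that] by (auto intro: mult_pos_pos mult_left_le)
  qed
  have finw: "finite {t. w e t \<noteq> 0}" for e
    by (rule finite_subset[of _ "{u e}"]) (auto simp: w_def split: if_splits)
  have fina': "finite {t. - a e t \<noteq> 0}" for e using fina by simp
  have W_eq: "W = (\<lambda>e t. - a e t + w e t)" by (simp add: W_def fun_eq_iff)
  have slope: "final_slope m W e = m e - A e + (if len e \<noteq> \<infinity> \<and> u e < l e then 1 else 0)" for e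
  proof -
    have "final_slope (\<lambda>_. 0) w e = 0 + (\<Sum>t\<in>{u e}. w e t)"
      by (rule final_slope_superset) (auto simp: w_def split: if_splits)
    then have "final_slope (\<lambda>_. 0) w e = (if len e \<noteq> \<infinity> \<and> u e < l e then 1 else 0)"
      by (simp add: w_def)
    moreover have "final_slope m (\<lambda>e t. - a e t) e = m e - A e"
      by (simp add: final_slope_def A_def sum_negf)
    ultimately show ?thesis
      using final_slope_add[of "\<lambda>e t. - a e t" e w m "\<lambda>_. 0", OF fina' finw] by (simp add: W_eq)
  qed
  have "pl_data \<phi> m W"
    unfolding pl_data_def
  proof (intro ballI conjI allI impI)
    fix e assume e: "e \<in> arcs G"
    show "finite {t. W e t \<noteq> 0}"
      by (rule finite_subset[of _ "{t. a e t \<noteq> 0} \<union> {t. w e t \<noteq> 0}"])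
        (use fina finw in \<open>auto simp: W_def\<close>)
    fix t assume "W e t \<noteq> 0"
    then have "a e t \<noteq> 0 \<or> w e t \<noteq> 0" by (auto simp: W_def)
    then have "0 < t \<and> ereal t < len e"
    proof
      assume "w e t \<noteq> 0"
      then have "len e \<noteq> \<infinity>" "u e < l e" "t = u e" by (auto simp: w_def split: if_splits)
      then show ?thesis using u(1)[OF e] len_eq[OF e] by simp
    qed (use a in blast)
    then show "0 < t" "ereal t < len e" by auto
  next
    fix e r assume e: "e \<in> arcs G" and r: "len e = ereal r"
    then have rl: "r = l e" by (simp add: l_def)
    have "hinges (\<lambda>t. - a e t) (l e) = - of_int (A e) * l e + P e"
      using hinges_affine[of "\<lambda>t. - a e t" "\<lambda>_. True" "l e", OF fina'] a(3)[of e] len_eq[OF e] r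
      by (simp add: A_def P_def sum_negf less_imp_le)
    moreover have "hinges (w e) (l e) = l e - u e"
      unfolding w_def hinges_single using u(2)[OF e] r by auto
    ultimately have "hinges (W e) (l e) = - of_int (A e) * l e + P e + (l e - u e)"
      using hinges_add[OF fina' finw, of e e "l e"] by (simp add: W_eq)
    moreover have "l e - u e = l e * \<sigma> e - l e * of_int \<lfloor>\<sigma> e\<rfloor>" by (simp add: u_def algebra_simps)
    moreover have "l e * \<sigma> e = \<phi> (head G e) - \<phi> (tail G e) + of_int (A e) * l e - P e"
      using l_pos[OF e] by (simp add: \<sigma>_def B_def field_simps)
    moreover have "m e = \<lfloor>\<sigma> e\<rfloor>" using r by (simp add: m_def)
    ultimately show "edge_value \<phi> m W e r = \<phi> (head G e)"
      by (simp add: edge_value_def rl algebra_simps)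
  qed
  moreover have "0 \<le> D (Vertex v) + vertex_ord m W v" if v: "v \<in> verts G" for v
  proof (cases "at_infinity v")
    case True
    then obtain e where e: "e \<in> arcs G" "len e = \<infinity>" "v = head G e" by (auto simp: at_infinity_def)
    then show ?thesis
      by (simp add: vertex_ord_def arcs_at_infinite_head slope m_def)
  next
    case False
    \<comment> \<open>For an infinite arc the inequality at its head says
      \<open>\<sigma> e + 1 \<le> A e + D (Vertex (head G e))\<close>, and the right-hand side is
      \<open>m e\<close>.\<close>
    have out: "\<sigma> e - 1 \<le> of_int (m e)" if e: "e \<in> out_arcs G v" for e
    proof (cases "len e = \<infinity>")
      case True
      then show ?thesis
        using \<sigma>[OF head_in_verts, of e] e by (simp add: arcs_at_infinite_head m_def)
    next
      case False
      then show ?thesis by (simp add: m_def)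
    qed
    have len_in: "len e \<noteq> \<infinity>" if "e \<in> in_arcs G v" for e using False that by (auto simp: at_infinity_def)
    \<comment> \<open>Rounding down and then raising by one exceeds the real slope by at most one,
      which the reserve at the head absorbs.\<close>
    have "in": "real_of_int (final_slope m W e) \<le> \<sigma> e - of_int (A e) + 1" if "e \<in> in_arcs G v" for e
    proof -
      have "of_int \<lfloor>\<sigma> e\<rfloor> \<le> \<sigma> e + 1" by linarith
      then show ?thesis using len_in[OF that] by (simp add: slope m_def)
    qed
    have "(0::real) \<le> of_int (D (Vertex v)) + (\<Sum>e\<in>out_arcs G v. \<sigma> e - 1)
        - (\<Sum>e\<in>in_arcs G v. \<sigma> e - of_int (A e) + 1)" by (rule \<sigma>[OF v])
    also have "\<dots> \<le> of_int (D (Vertex v)) + (\<Sum>e\<in>out_arcs G v. of_int (m e))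
        - (\<Sum>e\<in>in_arcs G v. of_int (final_slope m W e))"
      by (intro add_mono diff_mono sum_mono out "in" order_refl)
    also have "\<dots> = of_int (D (Vertex v) + vertex_ord m W v)" by (simp add: vertex_ord_def)
    finally show ?thesis by (simp only: of_int_0_le_iff)
  qed
  moreover have "0 \<le> D (Inner e t) + W e t" for e t by (simp add: W_def a_def w_def)
  ultimately show thesis by (rule that)
qed

end

theorem corollary43:
  fixes G :: "('v, 'e) pre_digraph" and len :: "'e \<Rightarrow> ereal"
    and D :: "('v, 'e) point \<Rightarrow> int"
  assumes "tropical_curve G len"
    and "metric_graph.divisor G len D"
    and "0 < metric_graph.degree D"
  shows "metric_graph.ample G len D"
proof -
  interpret tropical_curve G len by fact
  define N where "N = 2 * int (card (arcs G)) + 2"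
  \<comment> \<open>Since \<open>degree D\<close> is at least 1, removing \<open>N\<close> times a
    point from \<open>k * D\<close> leaves degree at least \<open>k - N\<close>, that is twice the
    number of arcs. Neither constant depends on the points to be separated, so one multiple works
    for all pairs.\<close>
  define k where "k = 4 * card (arcs G) + 2"
  have "very_ample (\<lambda>x. int k * D x)"
    unfolding very_ample_def
  proof (intro ballI impI)
    fix x x' assume x: "x \<in> points" "x' \<in> points" "x \<noteq> x'"
    define X where "X y = (if x = y then 1 else 0 :: int)" for y
    have "{y. X y \<noteq> 0} = {x}" by (auto simp: X_def)
    then have X: "divisor X" "degree X = 1" using x by (auto simp: divisor_def degree_def X_def)
    have k: "int k = N + 2 * int (card (arcs G))" by (simp add: k_def N_def)
    have "degree (\<lambda>y. int k * D y + (- N) * X y) = int k * degree D - N"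
      unfolding degree_combination(2)[OF assms(2) X(1)] using X(2) by simp
    also have "\<dots> \<ge> int k * 1 - N"
      using assms(3) by (intro diff_right_mono mult_left_mono) auto
    finally have "2 * int (card (arcs G)) \<le> degree (\<lambda>y. int k * D y + (- N) * X y)" using k by simp
    then obtain \<phi> m W where f: "pl_data \<phi> m W"
        "\<And>v. v \<in> verts G \<Longrightarrow> 0 \<le> int k * D (Vertex v) + (- N) * X (Vertex v) + vertex_ord m W v"
        "\<And>e t. 0 \<le> int k * D (Inner e t) + (- N) * X (Inner e t) + W e t"
      using equivalent_to_effective[OF degree_combination(1)[OF assms(2) X(1)]] by blast
    have NX_eq: "N * X y = (if x = y then 2 * int (card (arcs G)) + 2 else 0)" for y
      by (simp add: N_def X_def)
    obtain \<phi>' m' W' where "separating_data x x' \<phi>' m' W'" using separating_data_exists[OF x] by blast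
    then have g: "pl_data \<phi>' m' W'" "pl_function \<phi>' m' W' x \<noteq> pl_function \<phi>' m' W' x'"
        "\<And>v. v \<in> verts G \<Longrightarrow> 0 \<le> vertex_ord m' W' v + N * X (Vertex v)"
        "\<And>e t. 0 \<le> W' e t + N * X (Inner e t)"
      unfolding separating_data_def NX_eq by blast+
    have NX: "0 \<le> N * X y" for y by (simp add: NX_eq)
    let ?f = "pl_function (\<lambda>v. \<phi> v + \<phi>' v) (\<lambda>e. m e + m' e) (\<lambda>e t. W e t + W' e t)"
    have "?f \<in> R (\<lambda>x. int k * D x)"
    proof (rule pl_function_in_R[OF pl_data_add[OF f(1) g(1)]])
      show "0 \<le> int k * D (Vertex v) + vertex_ord (\<lambda>e. m e + m' e) (\<lambda>e t. W e t + W' e t) v"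
        if "v \<in> verts G" for v
        unfolding vertex_ord_add[OF f(1) g(1)] using f(2)[OF that] g(3)[OF that] by linarith
      show "0 \<le> int k * D (Inner e t) + (W e t + W' e t)" for e t
        using f(3)[of e t] g(4)[of e t] by linarith
    qed
    moreover have "pl_function \<phi> m W \<in> R (\<lambda>x. int k * D x)"
    proof (rule pl_function_in_R[OF f(1)])
      show "0 \<le> int k * D (Vertex v) + vertex_ord m W v" if "v \<in> verts G" for v
        using f(2)[OF that] NX[of "Vertex v"] by linarith
      show "0 \<le> int k * D (Inner e t) + W e t" for e t
        using f(3)[of e t] NX[of "Inner e t"] by linarith
    qed
    ultimately show "\<exists>f\<in>R (\<lambda>x. int k * D x). \<exists>f'\<in>R (\<lambda>x. int k * D x). \<exists>h.
        is_difference h f f' \<and> h x \<noteq> h x'"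
      using is_difference_pl_function_add[OF f(1) g(1)] g(2) by blast
  qed
  then show ?thesis unfolding ample_def by (intro exI[of _ k]) (simp add: k_def)
qed

end
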